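(* Assume that M-CLP and M-CLP$^*$ have optimal solutions $U_O(t)$ and $P_O(t)$ with no duality gap (equal objective values). Then: (i) $c^{T}U_O(t)$ is piecewise linear on $(0,T)$ with a finite number of breakpoints. (ii) There exists an optimal solution $U^*(t)$ of M-CLP that is continuous and piecewise linear on $(0,T)$. (iii) If in addition the vector $c\in\mathbb R^J$ is in general position to the matrix $[A^{T}\ I]$ (that is, $c$ is not a linear combination of any fewer than $J$ columns of $[A^{T}\ I]$), then every optimal solution of M-CLP is continuous and piecewise linear on $(0,T)$, and furthermore $U_O(t)-U_O(0+)$ is unique over $(0,T)$, i.e. it is the same function on $(0,T)$ for all optimal solutions $U_O$ of M-CLP.
   Context: Let $T>0$, $A$ a constant $K\times J$ matrix, $\beta,b\in\mathbb R^K$, $\gamma,c\in\mathbb R^J$ constant vectors; $I$ is the $J\times J$ identity matrix. Superscript $T$ on vectors/matrices is transpose; vector inequalities are componentwise. M-CLP: maximize $\int_{0-}^T(\gamma+(T-t)c)^{T}dU(t)$ subject to $AU(t)\le\beta+bt$ for $0\le t\le T$, where $U:[0,T]\to\mathbb R^J$ is non-negative, non-decreasing and right-continuous. M-CLP$^*$: minimize $\int_{0-}^T(\beta+(T-t)b)^{T}dP(t)$ subject to $A^{T}P(t)\ge\gamma+ct$ for $0\le t\le T$, where $P:[0,T]\to\mathbb R^K$ is non-negative, non-decreasing and right-continuous. Integrals are Lebesgue–Stieltjes over $[0,T]$ with the convention $U(0-)=0$, $P(0-)=0$, so atoms at $0$ (of sizes $U(0)$, $P(0)$) and at $T$ are included.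 "Piecewise linear" means with finitely many pieces. *)

theory Defs
  imports "HOL-Analysis.Analysis"
begin

text \<open>Orders on vectors are componentwise. A feasible function is a total function on the reals,
  of which only the values on \<open>[0, T]\<close> matter.\<close>

definition admissible :: "real \<Rightarrow> (real \<Rightarrow> real ^ 'n) \<Rightarrow> bool" where
  "admissible T U \<longleftrightarrow>
     (\<forall>t\<in>{0..T}. 0 \<le> U t) \<and>
     mono_on {0..T} U \<and>
     (\<forall>t\<in>{0..<T}. continuous (at_right t) U)"

text \<open>Extending \<open>u\<close> by \<open>0\<close> to the left of \<open>[0, T]\<close> encodes the convention \<open>u(0-) = 0\<close>, so that
  the Stieltjes measure has an atom of size \<open>u 0\<close> at \<open>0\<close>; extending it by \<open>u T\<close> to the
  right keeps the extension monotone and right-continuous, and keeps a possible atom at \<open>T\<close>.\<close>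

definition stieltjes_extension :: "real \<Rightarrow> (real \<Rightarrow> real) \<Rightarrow> real \<Rightarrow> real" where
  "stieltjes_extension T u t = (if t < 0 then 0 else if t \<le> T then u t else u T)"

definition stieltjes_integral :: "real \<Rightarrow> (real \<Rightarrow> real ^ 'n) \<Rightarrow> (real \<Rightarrow> real ^ 'n) \<Rightarrow> real" where
  "stieltjes_integral T g U =
     (\<Sum>i\<in>UNIV. LINT t:{0..T}|interval_measure (stieltjes_extension T (\<lambda>s. U s $ i)). g t $ i)"

definition mclp_feasible ::
    "real \<Rightarrow> real ^ 'j ^ 'k \<Rightarrow> real ^ 'k \<Rightarrow> real ^ 'k \<Rightarrow> (real \<Rightarrow> real ^ 'j) \<Rightarrow> bool" where
  "mclp_feasible T A \<beta> b U \<longleftrightarrow>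
     admissible T U \<and> (\<forall>t\<in>{0..T}. A *v U t \<le> \<beta> + t *\<^sub>R b)"

definition mclp_value ::
    "real \<Rightarrow> real ^ 'j \<Rightarrow> real ^ 'j \<Rightarrow> (real \<Rightarrow> real ^ 'j) \<Rightarrow> real" where
  "mclp_value T \<gamma> c U = stieltjes_integral T (\<lambda>t. \<gamma> + (T - t) *\<^sub>R c) U"

definition mclp_optimal ::
    "real \<Rightarrow> real ^ 'j ^ 'k \<Rightarrow> real ^ 'k \<Rightarrow> real ^ 'k \<Rightarrow> real ^ 'j \<Rightarrow> real ^ 'j \<Rightarrow>
      (real \<Rightarrow> real ^ 'j) \<Rightarrow> bool" where
  "mclp_optimal T A \<beta> b \<gamma> c U \<longleftrightarrow>
     mclp_feasible T A \<beta> b U \<and>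
     (\<forall>V. mclp_feasible T A \<beta> b V \<longrightarrow> mclp_value T \<gamma> c V \<le> mclp_value T \<gamma> c U)"

definition mclp_dual_feasible ::
    "real \<Rightarrow> real ^ 'j ^ 'k \<Rightarrow> real ^ 'j \<Rightarrow> real ^ 'j \<Rightarrow> (real \<Rightarrow> real ^ 'k) \<Rightarrow> bool" where
  "mclp_dual_feasible T A \<gamma> c P \<longleftrightarrow>
     admissible T P \<and> (\<forall>t\<in>{0..T}. transpose A *v P t \<ge> \<gamma> + t *\<^sub>R c)"

definition mclp_dual_value ::
    "real \<Rightarrow> real ^ 'k \<Rightarrow> real ^ 'k \<Rightarrow> (real \<Rightarrow> real ^ 'k) \<Rightarrow> real" where
  "mclp_dual_value T \<beta> b P = stieltjes_integral T (\<lambda>t. \<beta> + (T - t) *\<^sub>R b) P"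

definition mclp_dual_optimal ::
    "real \<Rightarrow> real ^ 'j ^ 'k \<Rightarrow> real ^ 'k \<Rightarrow> real ^ 'k \<Rightarrow> real ^ 'j \<Rightarrow> real ^ 'j \<Rightarrow>
      (real \<Rightarrow> real ^ 'k) \<Rightarrow> bool" where
  "mclp_dual_optimal T A \<beta> b \<gamma> c P \<longleftrightarrow>
     mclp_dual_feasible T A \<gamma> c P \<and>
     (\<forall>Q. mclp_dual_feasible T A \<gamma> c Q \<longrightarrow> mclp_dual_value T \<beta> b P \<le> mclp_dual_value T \<beta> b Q)"

text \<open>Piecewise linear (affine pieces) on the open interval \<open>(l, r)\<close>, with finitely many
  breakpoints. Jumps at the breakpoints are allowed; continuity is always stated separately.\<close>

definition piecewise_linear_on :: "real \<Rightarrow> real \<Rightarrow> (real \<Rightarrow> 'a::real_vector) \<Rightarrow> bool" where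
  "piecewise_linear_on l r f \<longleftrightarrow>
     (\<exists>(n::nat) (\<tau>::nat \<Rightarrow> real). \<tau> 0 = l \<and> \<tau> n = r \<and> (\<forall>i<n. \<tau> i < \<tau> (Suc i)) \<and>
       (\<forall>i<n. \<exists>v w. \<forall>t\<in>{\<tau> i<..<\<tau> (Suc i)}. f t = w + t *\<^sub>R v))"

text \<open>The block matrix \<open>[M I]\<close>.\<close>

definition append_identity :: "real ^ 'k ^ 'j \<Rightarrow> real ^ ('k + 'j) ^ 'j" where
  "append_identity M = (\<chi> i l. case l of Inl k \<Rightarrow> M $ i $ k | Inr j \<Rightarrow> mat 1 $ i $ j)"

text \<open>\<open>v\<close> is not a linear combination of fewer columns of \<open>M\<close> than \<open>M\<close> has rows.\<close>

definition general_position :: "real ^ 'm \<Rightarrow> real ^ 'n ^ 'm \<Rightarrow> bool" where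
  "general_position v M \<longleftrightarrow>
     (\<forall>S. card S < CARD('m) \<longrightarrow> v \<notin> span ((\<lambda>l. column l M) ` S))"

end

theory Submission
  imports Defs
begin

text \<open>The key to the theorem is that Fubini turns the objective of M-CLP into
\<open>\<gamma> \<bullet> U T + integral {0..T} (\<lambda>t. c \<bullet> U t)\<close> (lemma \<open>mclp_value_eq\<close>). The constraints are
affine in \<open>t\<close>, so on any interval \<open>[s, r]\<close> a feasible \<open>U\<close> may be replaced by the chord
through its end values. For an optimal \<open>U\<close> this cannot increase the integral of \<open>c \<bullet> U\<close>,
and a right-continuous function with left limits whose chords never have a larger integral than
the function itself has no jumps and is concave. Hence \<open>c \<bullet> U\<close> is continuous and concave on \<open>(0, T)\<close>
(\<open>mclp_optimal_rate_concave\<close>).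

The absence of a duality gap enters through complementary slackness
(\<open>complementary_slackness\<close>): where a component of \<open>U\<close> increases, the time-reversed dual slack has a
zero, and symmetrically. By monotonicity and one-sided continuity every interval contains a
subinterval on which each component of \<open>U\<close> is constant or has identically vanishing
dual slack, and likewise for \<open>P\<close>. On such an interval \<open>c \<bullet> U\<close> is
affine, and its slope depends only on which of the two alternatives holds for each component
(\<open>activity_pattern_slope\<close>). There are finitely many patterns, so the concave function
\<open>c \<bullet> U\<close> has finitely many slopes on a dense open set. It is therefore the minimum of
finitely many affine functions, which gives (i).

For (ii), \<open>U\<close> is replaced by chords between the breakpoints of \<open>c \<bullet> U\<close>; this
leaves \<open>c \<bullet> U\<close>, and hence the objective, unchanged.

For (iii), the dual problem is itself an M-CLP, so by (ii) it has a continuous piecewise linear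
optimum \<open>P\<close>. On a piece on which \<open>P\<close> is affine with slope \<open>v\<close>, the dual slack
has slope \<open>transpose A *v v - c\<close>, which exhibits \<open>c\<close> as a combination of the columns of
\<open>[transpose A, I]\<close> carried by the supports of \<open>v\<close> and of that slope. General position
forces these columns to span. Complementary slackness prescribes the scalar product of the increments of
every optimal \<open>U\<close> with each of them, so all optimal solutions have the same constant rate on
the piece. At a breakpoint a jump \<open>\<delta>\<close> satisfies \<open>c \<bullet> \<delta> = 0\<close>, because \<open>c \<bullet> U\<close> is continuous;
the sign conditions on the two slacks make this a sum of nonpositive terms, and general position
then gives \<open>\<delta> = 0\<close>.\<close>

section \<open>Stieltjes integrals against monotone functions\<close>

text \<open>The scalar form of \<open>admissible\<close>: the distribution functions whose Stieltjes measures occur.\<close>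

definition increasing_rcont :: "real \<Rightarrow> (real \<Rightarrow> real) \<Rightarrow> bool" where
  "increasing_rcont T u \<longleftrightarrow>
     (\<forall>t\<in>{0..T}. 0 \<le> u t) \<and> mono_on {0..T} u \<and> (\<forall>t\<in>{0..<T}. continuous (at_right t) u)"

lemma admissible_iff_components:
  "admissible T U \<longleftrightarrow> (\<forall>i. increasing_rcont T (\<lambda>t. U t $ i))"
  unfolding admissible_def increasing_rcont_def mono_on_def less_eq_vec_def
  by (auto simp: continuous_within intro: tendsto_vec_nth vec_tendstoI)

lemma increasing_rcont_component:
  "admissible T U \<Longrightarrow> increasing_rcont T (\<lambda>t. U t $ i)"
  by (simp add: admissible_iff_components)

lemma stieltjes_extension_in [simp]:
  "0 \<le> t \<Longrightarrow> t \<le> T \<Longrightarrow> stieltjes_extension T u t = u t"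
  by (simp add: stieltjes_extension_def)

lemma stieltjes_extension_mono:
  assumes "increasing_rcont T u" "0 < T" "x \<le> y"
  shows "stieltjes_extension T u x \<le> stieltjes_extension T u y"
  using assms unfolding increasing_rcont_def stieltjes_extension_def
  by (auto simp: mono_on_def)

lemma stieltjes_extension_nonneg:
  assumes "increasing_rcont T u" "0 < T"
  shows "0 \<le> stieltjes_extension T u x"
  using assms unfolding increasing_rcont_def stieltjes_extension_def by auto

lemma stieltjes_extension_rcont:
  assumes u: "increasing_rcont T u" and T: "0 < T"
  shows "continuous (at_right a) (stieltjes_extension T u)"
proof -
  consider "a < 0" | "0 \<le> a" "a < T" | "T \<le> a" by linarith
  then show ?thesis
  proof cases
    case 1
    have "\<forall>\<^sub>F x in at_right a. stieltjes_extension T u x = 0"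
      using eventually_at_right[OF 1] 1 by (auto simp: stieltjes_extension_def intro!: exI[of _ 0])
    then show ?thesis
      using 1 by (simp add: continuous_within stieltjes_extension_def tendsto_eventually)
  next
    case 2
    have "\<forall>\<^sub>F x in at_right a. u x = stieltjes_extension T u x"
      using eventually_at_right[OF 2(2)] 2 by (auto simp: stieltjes_extension_def intro!: exI[of _ T])
    moreover have "(u \<longlongrightarrow> u a) (at_right a)"
      using u 2 by (simp add: increasing_rcont_def continuous_within)
    ultimately show ?thesis
      using 2 by (simp add: continuous_within Lim_transform_eventually)
  next
    case 3
    have "\<forall>\<^sub>F x in at_right a. stieltjes_extension T u x = u T"
      using eventually_at_right[of a "a+1"] 3 T
      by (auto simp: stieltjes_extension_def intro!: exI[of _ "a+1"])
    then show ?thesis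
      using 3 T by (cases "a = T") (simp_all add: continuous_within stieltjes_extension_def tendsto_eventually)
  qed
qed

lemma stieltjes_measure_Ioc:
  assumes "increasing_rcont T u" "0 < T" "a \<le> b"
  shows "emeasure (interval_measure (stieltjes_extension T u)) {a<..b}
    = ennreal (stieltjes_extension T u b - stieltjes_extension T u a)"
  using assms
  by (intro emeasure_interval_measure_Ioc stieltjes_extension_mono stieltjes_extension_rcont) auto

text \<open>The extension vanishes to the left of \<open>0\<close>, so the atom at \<open>0\<close> is included and
initial segments have mass \<open>u t\<close> rather than \<open>u t - u 0\<close>.\<close>

lemma stieltjes_measure_Icc:
  assumes u: "increasing_rcont T u" and T: "0 < T" and t: "0 \<le> t" "t \<le> T"
  shows "emeasure (interval_measure (stieltjes_extension T u)) {0..t} = ennreal (u t)"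
proof -
  let ?M = "interval_measure (stieltjes_extension T u)"
  \<comment> \<open>The mass of \<open>{0..t}\<close> is computed from a half-open interval reaching below \<open>0\<close>, where the measure has no mass.\<close>
  have "{-1<..<0} = (\<Union>n. {-1<..- 1 / real (Suc n)})"
  proof (intro set_eqI iffI)
    fix x :: real assume x: "x \<in> {-1<..<0}"
    then obtain n where "inverse (real (Suc n)) < - x"
      using reals_Archimedean[of "- x"] by auto
    with x show "x \<in> (\<Union>n. {-1<..- 1 / real (Suc n)})"
      by (auto simp: field_simps intro!: exI[of _ n])
  next
    fix x :: real assume "x \<in> (\<Union>n. {-1<..- 1 / real (Suc n)})"
    then obtain n where n: "-1 < x" "x \<le> - 1 / real (Suc n)" by auto
    have "- 1 / real (Suc n) < 0" by simp
    with n(2) have "x < 0" by (rule le_less_trans)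
    with n(1) show "x \<in> {-1<..<0}" by simp
  qed
  moreover have "emeasure ?M (\<Union>n. {-1<..- 1 / real (Suc n)}) = 0"
    using stieltjes_measure_Ioc[OF u T, of "-1"]
    by (intro emeasure_UN_eq_0) (auto simp: stieltjes_extension_def divide_simps)
  ultimately have null: "emeasure ?M {-1<..<0} = 0" by simp
  have "emeasure ?M {-1<..t} = emeasure ?M ({-1<..<0} \<union> {0..t})"
    using t by (intro arg_cong[of _ _ "emeasure ?M"]) auto
  also have "\<dots> = emeasure ?M {0..t}"
    by (subst plus_emeasure[symmetric]) (auto simp: null)
  finally show ?thesis
    using stieltjes_measure_Ioc[OF u T, of "-1" t] t by (simp add: stieltjes_extension_def)
qed

lemma stieltjes_extension_measurable:
  assumes "increasing_rcont T u" "0 < T"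
  shows "stieltjes_extension T u \<in> borel_measurable borel"
  using stieltjes_extension_mono[OF assms] by (intro borel_measurable_mono) (auto simp: mono_def)

text \<open>Both sides are the product measure of the triangle \<open>{(t, s). 0 \<le> t, 0 \<le> s, t + s \<le> T}\<close>.
With two Stieltjes measures this is the symmetry behind weak duality; with Lebesgue measure as one
of them it is integration by parts.\<close>

lemma nn_integral_initial_segments:
  fixes M N :: "real measure"
  assumes M: "sets M = sets borel" "sigma_finite_measure M"
    and N: "sets N = sets borel" "sigma_finite_measure N"
  shows "(\<integral>\<^sup>+t. emeasure N {0..T - t} * indicator {0..T} t \<partial>M)
       = (\<integral>\<^sup>+s. emeasure M {0..T - s} * indicator {0..T} s \<partial>N)"
proof -
  interpret pair_sigma_finite M N
    using M N by (simp add: pair_sigma_finite_def)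
  let ?S = "{p::real \<times> real. 0 \<le> fst p \<and> 0 \<le> snd p \<and> fst p + snd p \<le> T}"
  have S: "closed ?S"
    by (intro closed_Collect_conj closed_Collect_le continuous_intros)
  have S': "?S \<in> sets (M \<Otimes>\<^sub>M N)"
  proof -
    have "sets (M \<Otimes>\<^sub>M N) = sets (borel \<Otimes>\<^sub>M borel)"
      using M N by (intro sets_pair_measure_cong)
    then show ?thesis using borel_closed[OF S] by (simp only: borel_prod)
  qed
  have slice: "emeasure K {0..T - t} * indicator {0..T} t = (\<integral>\<^sup>+s. indicator ?S (t, s) \<partial>K)"
    if "sets K = sets borel" for K :: "real measure" and t
  proof -
    have "(\<integral>\<^sup>+s. indicator ?S (t, s) \<partial>K) = (\<integral>\<^sup>+s. indicator {0..T} t * indicator {0..T - t} s \<partial>K)"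
      by (intro nn_integral_cong) (auto simp: indicator_def)
    also have "\<dots> = indicator {0..T} t * emeasure K {0..T - t}"
      using that by (intro nn_integral_cmult_indicator) simp
    finally show ?thesis by (simp only: mult.commute)
  qed
  have "(\<integral>\<^sup>+t. emeasure N {0..T - t} * indicator {0..T} t \<partial>M)
      = (\<integral>\<^sup>+t. (\<integral>\<^sup>+s. indicator ?S (t, s) \<partial>N) \<partial>M)"
    by (intro nn_integral_cong slice N)
  also have "\<dots> = (\<integral>\<^sup>+s. (\<integral>\<^sup>+t. indicator ?S (t, s) \<partial>M) \<partial>N)"
    using S' by (intro Fubini'[symmetric]) simp
  also have "\<dots> = (\<integral>\<^sup>+s. (\<integral>\<^sup>+t. indicator ?S (s, t) \<partial>M) \<partial>N)"
    by (intro nn_integral_cong) (auto simp: indicator_def add.commute)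
  also have "\<dots> = (\<integral>\<^sup>+s. emeasure M {0..T - s} * indicator {0..T} s \<partial>N)"
    by (intro nn_integral_cong slice[symmetric] M)
  finally show ?thesis .
qed

lemma set_lebesgue_integral_initial_segments:
  fixes M N :: "real measure" and F G :: "real \<Rightarrow> real"
  assumes M: "sets M = sets borel" "sigma_finite_measure M"
    and N: "sets N = sets borel" "sigma_finite_measure N"
    and F: "\<And>t. t \<in> {0..T} \<Longrightarrow> emeasure M {0..t} = ennreal (F t)"
      "\<And>t. 0 \<le> F t" "F \<in> borel_measurable borel"
    and G: "\<And>t. t \<in> {0..T} \<Longrightarrow> emeasure N {0..t} = ennreal (G t)"
      "\<And>t. 0 \<le> G t" "G \<in> borel_measurable borel"
  shows "(LINT t:{0..T}|M. G (T - t)) = (LINT s:{0..T}|N. F (T - s))"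
proof -
  have eq: "(LINT t:{0..T}|L. H (T - t)) = enn2real (\<integral>\<^sup>+t. emeasure K {0..T - t} * indicator {0..T} t \<partial>L)"
    if "sets L = sets borel" "\<And>t. t \<in> {0..T} \<Longrightarrow> emeasure K {0..t} = ennreal (H t)"
      "\<And>t. 0 \<le> H t" "H \<in> borel_measurable borel"
    for K L :: "real measure" and H
  proof -
    note [measurable] = that(4) and [measurable_cong] = that(1)
    have "(LINT t:{0..T}|L. H (T - t)) = enn2real (\<integral>\<^sup>+t. ennreal (indicator {0..T} t *\<^sub>R H (T - t)) \<partial>L)"
      unfolding set_lebesgue_integral_def using that(3) by (intro integral_eq_nn_integral) auto
    also have "(\<integral>\<^sup>+t. ennreal (indicator {0..T} t *\<^sub>R H (T - t)) \<partial>L)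
        = (\<integral>\<^sup>+t. emeasure K {0..T - t} * indicator {0..T} t \<partial>L)"
      using that(2) by (intro nn_integral_cong) (auto simp: indicator_def)
    finally show ?thesis .
  qed
  have "(LINT t:{0..T}|M. G (T - t)) = enn2real (\<integral>\<^sup>+t. emeasure N {0..T - t} * indicator {0..T} t \<partial>M)"
    using M(1) G by (rule eq)
  also have "\<dots> = enn2real (\<integral>\<^sup>+s. emeasure M {0..T - s} * indicator {0..T} s \<partial>N)"
    by (rule arg_cong[OF nn_integral_initial_segments[OF M N]])
  also have "\<dots> = (LINT s:{0..T}|N. F (T - s))"
    using N(1) F by (rule eq[symmetric])
  finally show ?thesis .
qed

lemma stieltjes_sigma_finite:
  assumes "increasing_rcont T u" "0 < T"
  shows "sigma_finite_measure (interval_measure (stieltjes_extension T u))"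
  using assms by (intro sigma_finite_interval_measure stieltjes_extension_mono stieltjes_extension_rcont)

lemma stieltjes_convolution_commute:
  assumes u: "increasing_rcont T u" and p: "increasing_rcont T p" and T: "0 < T"
  shows "(LINT t:{0..T}|interval_measure (stieltjes_extension T u). p (T - t))
       = (LINT t:{0..T}|interval_measure (stieltjes_extension T p). u (T - t))"
proof -
  let ?u = "stieltjes_extension T u" and ?p = "stieltjes_extension T p"
  have *: "(LINT t:{0..T}|M. stieltjes_extension T v (T - t)) = (LINT t:{0..T}|M. v (T - t))"
    if "sets M = sets borel" for v :: "real \<Rightarrow> real" and M :: "real measure"
    using that by (intro set_lebesgue_integral_cong) auto
  have "(LINT t:{0..T}|interval_measure ?u. ?p (T - t)) = (LINT t:{0..T}|interval_measure ?p. ?u (T - t))"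
    using u p T
    by (intro set_lebesgue_integral_initial_segments)
      (auto simp: stieltjes_sigma_finite stieltjes_measure_Icc stieltjes_extension_nonneg
        stieltjes_extension_measurable)
  then show ?thesis by (simp add: *)
qed

lemma stieltjes_integral_time_to_go:
  assumes u: "increasing_rcont T u" and T: "0 < T"
  shows "(LINT t:{0..T}|interval_measure (stieltjes_extension T u). T - t) = integral {0..T} u"
proof -
  let ?u = "stieltjes_extension T u"
  note [measurable] = stieltjes_extension_measurable[OF u T]
  have "(LINT t:{0..T}|interval_measure ?u. max 0 (T - t)) = (LINT s:{0..T}|lborel. ?u (T - s))"
    using u T
    by (intro set_lebesgue_integral_initial_segments)
      (auto simp: stieltjes_sigma_finite stieltjes_measure_Icc stieltjes_extension_nonneg
        stieltjes_extension_measurable lborel.sigma_finite_measure_axioms)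
  moreover have "(LINT t:{0..T}|interval_measure ?u. max 0 (T - t))
      = (LINT t:{0..T}|interval_measure ?u. T - t)"
    by (intro set_lebesgue_integral_cong) auto
  moreover have "(LINT s:{0..T}|lborel. ?u (T - s)) = (LINT s:{0..T}|lborel. ?u s)"
  proof -
    have "(LINT s:{0..T}|lborel. ?u s) = (\<integral>s. indicator {0..T} (T - s) *\<^sub>R ?u (T - s) \<partial>lborel)"
      unfolding set_lebesgue_integral_def
      by (subst lborel_integral_real_affine[where t = T and c = "-1"]) auto
    also have "\<dots> = (LINT s:{0..T}|lborel. ?u (T - s))"
      unfolding set_lebesgue_integral_def
      by (intro Bochner_Integration.integral_cong) (auto simp: indicator_def)
    finally show ?thesis ..
  qed
  moreover have "(LINT s:{0..T}|lborel. ?u s) = integral {0..T} ?u"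
  proof (intro set_borel_integral_eq_integral)
    show "set_integrable lborel {0..T} ?u"
      unfolding set_integrable_def
    proof (rule integrableI_bounded_set_indicator[where B = "u T"])
      show "AE x in lborel. x \<in> {0..T} \<longrightarrow> norm (?u x) \<le> u T"
      proof (intro AE_I2 impI)
        fix x assume "x \<in> {0..T}"
        then have "0 \<le> ?u x" "?u x \<le> ?u T"
          using u T by (auto intro!: stieltjes_extension_nonneg stieltjes_extension_mono simp del: stieltjes_extension_in)
        then show "norm (?u x) \<le> u T" using T by simp
      qed
    qed (use T in auto)
  qed
  moreover have "integral {0..T} ?u = integral {0..T} u"
    by (intro integral_cong) auto
  ultimately show ?thesis by simp
qed

lemma stieltjes_set_integrable:
  fixes f :: "real \<Rightarrow> real"
  assumes u: "increasing_rcont T u" and T: "0 < T"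
    and f: "f \<in> borel_measurable borel" "\<And>t. t \<in> {0..T} \<Longrightarrow> \<bar>f t\<bar> \<le> B"
  shows "set_integrable (interval_measure (stieltjes_extension T u)) {0..T} f"
  unfolding set_integrable_def
proof (rule integrableI_bounded_set_indicator[where B = B])
  show "f \<in> borel_measurable (interval_measure (stieltjes_extension T u))"
    using f(1) by (subst measurable_cong_sets[OF sets_interval_measure refl])
  show "emeasure (interval_measure (stieltjes_extension T u)) {0..T} < \<infinity>"
    using stieltjes_measure_Icc[OF u T, of T] T by simp
qed (use f(2) in auto)

lemma stieltjes_affine_integral:
  assumes u: "increasing_rcont T u" and T: "0 < T"
  shows "(LINT t:{0..T}|interval_measure (stieltjes_extension T u). g + (T - t) * d)
       = g * u T + d * integral {0..T} u"
proof -
  let ?M = "interval_measure (stieltjes_extension T u)"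
  have i: "set_integrable ?M {0..T} (\<lambda>t. g)" "set_integrable ?M {0..T} (\<lambda>t. T - t)"
    using stieltjes_set_integrable[OF u T, of "\<lambda>t. g" "\<bar>g\<bar>"]
      stieltjes_set_integrable[OF u T, of "\<lambda>t. T - t" T] by auto
  have "(LINT t:{0..T}|?M. g) = g * u T"
    using stieltjes_measure_Icc[OF u T, of T] T u
    by (simp add: set_lebesgue_integral_def measure_def increasing_rcont_def)
  moreover have "(LINT t:{0..T}|?M. (T - t) * d) = d * integral {0..T} u"
    using stieltjes_integral_time_to_go[OF u T] by simp
  ultimately show ?thesis
    using i by (subst set_integral_add) auto
qed

text \<open>A nonnegative function with zero integral vanishes almost everywhere, and
\<open>{s<..r}\<close> has positive mass as soon as \<open>u\<close> increases from \<open>s\<close> to \<open>r\<close>.\<close>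

lemma stieltjes_zero_at_increase:
  fixes f :: "real \<Rightarrow> real"
  assumes u: "increasing_rcont T u" and T: "0 < T"
    and f: "set_integrable (interval_measure (stieltjes_extension T u)) {0..T} f"
      "\<And>t. t \<in> {0..T} \<Longrightarrow> 0 \<le> f t"
    and zero: "(LINT t:{0..T}|interval_measure (stieltjes_extension T u). f t) = 0"
    and st: "0 \<le> s" "s < r" "r \<le> T" "u s < u r"
  shows "\<exists>t\<in>{s<..r}. f t = 0"
proof (rule ccontr)
  let ?M = "interval_measure (stieltjes_extension T u)"
  assume no: "\<not> (\<exists>t\<in>{s<..r}. f t = 0)"
  have "AE t in ?M. 0 \<le> indicator {0..T} t *\<^sub>R f t"
    using f by (auto simp: indicator_def)
  then have "AE t in ?M. indicator {0..T} t *\<^sub>R f t = 0"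
    using f(1) zero integral_nonneg_eq_0_iff_AE[of ?M "\<lambda>t. indicator {0..T} t *\<^sub>R f t"]
    unfolding set_lebesgue_integral_def set_integrable_def by blast
  then have "AE t in ?M. t \<notin> {s<..r}"
  proof eventually_elim
    case (elim t)
    show ?case
    proof
      assume t: "t \<in> {s<..r}"
      then have "f t = 0" using elim st by (simp add: indicator_def)
      then show False using no t by blast
    qed
  qed
  then have "emeasure ?M {s<..r} = 0"
    by (subst (asm) AE_iff_null_sets[symmetric]) (simp_all add: null_sets_def)
  then show False
    using stieltjes_measure_Ioc[OF u T, of s r] st by simp
qed

section \<open>Complementary slackness\<close>

lemma increasing_rcont_integrable:
  assumes "increasing_rcont T u"
  shows "u integrable_on {0..T}"
  using assms by (intro integrable_on_mono_on) (simp add: increasing_rcont_def)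

text \<open>In this form the objective depends only on the terminal value and the path of \<open>c \<bullet> U\<close>,
which makes modifications of \<open>U\<close> inside \<open>[0, T]\<close> easy to compare.\<close>

lemma mclp_value_eq:
  assumes U: "admissible T U" and T: "0 < T"
  shows "mclp_value T \<gamma> c U = \<gamma> \<bullet> U T + integral {0..T} (\<lambda>t. c \<bullet> U t)"
proof -
  note u = increasing_rcont_component[OF U]
  have "mclp_value T \<gamma> c U = (\<Sum>i\<in>UNIV. \<gamma> $ i * U T $ i + c $ i * integral {0..T} (\<lambda>t. U t $ i))"
    unfolding mclp_value_def stieltjes_integral_def
    using stieltjes_affine_integral[OF u T] by simp
  moreover have "integral {0..T} (\<lambda>t. c \<bullet> U t) = (\<Sum>i\<in>UNIV. c $ i * integral {0..T} (\<lambda>t. U t $ i))"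
    unfolding inner_vec_def inner_real_def
    using increasing_rcont_integrable[OF u]
    by (subst integral_sum) (auto intro: integrable_on_mult_right)
  ultimately show ?thesis
    by (simp add: sum.distrib inner_vec_def)
qed

lemma reversed_set_integrable:
  assumes u: "increasing_rcont T u" and p: "increasing_rcont T p" and T: "0 < T"
  shows "set_integrable (interval_measure (stieltjes_extension T u)) {0..T} (\<lambda>t. p (T - t))"
proof -
  note [measurable] = stieltjes_extension_measurable[OF p T]
  have "\<bar>stieltjes_extension T p (T - t)\<bar> \<le> p T" if "t \<in> {0..T}" for t
    using stieltjes_extension_nonneg[OF p T, of "T - t"] stieltjes_extension_mono[OF p T, of "T - t" T]
      that T by simp
  then have "set_integrable (interval_measure (stieltjes_extension T u)) {0..T}
      (\<lambda>t. stieltjes_extension T p (T - t))"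
    by (intro stieltjes_set_integrable[OF u T]) auto
  moreover have "set_integrable (interval_measure (stieltjes_extension T u)) {0..T}
      (\<lambda>t. stieltjes_extension T p (T - t)) \<longleftrightarrow>
    set_integrable (interval_measure (stieltjes_extension T u)) {0..T} (\<lambda>t. p (T - t))"
    by (intro set_integrable_cong) auto
  ultimately show ?thesis by simp
qed

lemma slack_set_integrable:
  fixes P :: "real \<Rightarrow> real ^ 'k"
  assumes u: "increasing_rcont T u" and P: "admissible T P" and T: "0 < T"
  shows "set_integrable (interval_measure (stieltjes_extension T u)) {0..T}
      (\<lambda>t. a \<bullet> P (T - t) - (g + (T - t) * d))"
    and "(LINT t:{0..T}|interval_measure (stieltjes_extension T u). a \<bullet> P (T - t) - (g + (T - t) * d))
      = (\<Sum>k\<in>UNIV. a $ k * (LINT t:{0..T}|interval_measure (stieltjes_extension T u). P (T - t) $ k))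
        - (LINT t:{0..T}|interval_measure (stieltjes_extension T u). g + (T - t) * d)"
proof -
  let ?M = "interval_measure (stieltjes_extension T u)"
  note i = reversed_set_integrable[OF u increasing_rcont_component[OF P] T]
  have "set_integrable ?M {0..T} (\<lambda>t. \<Sum>k\<in>UNIV. a $ k * P (T - t) $ k)"
    using set_integrable_mult_right[OF i]
    unfolding set_integrable_def scaleR_sum_right by (intro Bochner_Integration.integrable_sum) auto
  then have 1: "set_integrable ?M {0..T} (\<lambda>t. a \<bullet> P (T - t))"
    by (simp add: inner_vec_def)
  have "\<bar>g + (T - t) * d\<bar> \<le> \<bar>g\<bar> + T * \<bar>d\<bar>" if "t \<in> {0..T}" for t
  proof -
    have "\<bar>(T - t) * d\<bar> \<le> T * \<bar>d\<bar>"
      using that by (auto simp: abs_mult intro!: mult_right_mono)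
    then show ?thesis by linarith
  qed
  then have 2: "set_integrable ?M {0..T} (\<lambda>t. g + (T - t) * d)"
    by (intro stieltjes_set_integrable[OF u T]) auto
  show "set_integrable ?M {0..T} (\<lambda>t. a \<bullet> P (T - t) - (g + (T - t) * d))"
    using 1 2 by (rule set_integral_diff)
  have "(LINT t:{0..T}|?M. a \<bullet> P (T - t)) = (LINT t:{0..T}|?M. \<Sum>k\<in>UNIV. a $ k * P (T - t) $ k)"
    by (simp add: inner_vec_def)
  also have "\<dots> = (\<Sum>k\<in>UNIV. LINT t:{0..T}|?M. a $ k * P (T - t) $ k)"
    using i unfolding set_lebesgue_integral_def set_integrable_def
    by (subst Bochner_Integration.integral_sum[symmetric])
      (auto simp: sum_distrib_left mult.left_commute intro!: integrable_mult_right)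
  finally have "(LINT t:{0..T}|?M. a \<bullet> P (T - t))
      = (\<Sum>k\<in>UNIV. a $ k * (LINT t:{0..T}|?M. P (T - t) $ k))"
    by simp
  then show "(LINT t:{0..T}|?M. a \<bullet> P (T - t) - (g + (T - t) * d))
      = (\<Sum>k\<in>UNIV. a $ k * (LINT t:{0..T}|?M. P (T - t) $ k)) - (LINT t:{0..T}|?M. g + (T - t) * d)"
    using set_integral_diff(2)[OF 1 2] by simp
qed

text \<open>Time runs in opposite directions in the two problems: the primal slack at \<open>t\<close> is paired
with the dual slack at \<open>T - t\<close>.\<close>

definition primal_slack :: "real ^ 'j ^ 'k \<Rightarrow> real ^ 'k \<Rightarrow> real ^ 'k \<Rightarrow> (real \<Rightarrow> real ^ 'j) \<Rightarrow> real \<Rightarrow> real ^ 'k" where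
  "primal_slack A \<beta> b U t = \<beta> + t *\<^sub>R b - A *v U t"

definition dual_slack :: "real ^ 'j ^ 'k \<Rightarrow> real ^ 'j \<Rightarrow> real ^ 'j \<Rightarrow> (real \<Rightarrow> real ^ 'k) \<Rightarrow> real \<Rightarrow> real ^ 'j" where
  "dual_slack A \<gamma> c P t = transpose A *v P t - (\<gamma> + t *\<^sub>R c)"

text \<open>A pointwise consequence of complementary slackness which mentions no integral: an increase over
\<open>{s<..r}\<close> forces a zero of the opposite slack there.\<close>

definition complementary ::
    "real \<Rightarrow> real ^ 'j ^ 'k \<Rightarrow> real ^ 'k \<Rightarrow> real ^ 'k \<Rightarrow> real ^ 'j \<Rightarrow> real ^ 'j \<Rightarrow>
      (real \<Rightarrow> real ^ 'j) \<Rightarrow> (real \<Rightarrow> real ^ 'k) \<Rightarrow> bool" where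
  "complementary T A \<beta> b \<gamma> c U P \<longleftrightarrow>
     (\<forall>j s r. 0 \<le> s \<longrightarrow> s < r \<longrightarrow> r \<le> T \<longrightarrow> U s $ j < U r $ j \<longrightarrow>
        (\<exists>t\<in>{s<..r}. dual_slack A \<gamma> c P (T - t) $ j = 0)) \<and>
     (\<forall>k s r. 0 \<le> s \<longrightarrow> s < r \<longrightarrow> r \<le> T \<longrightarrow> P s $ k < P r $ k \<longrightarrow>
        (\<exists>t\<in>{s<..r}. primal_slack A \<beta> b U (T - t) $ k = 0))"

lemma complementaryD:
  assumes "complementary T A \<beta> b \<gamma> c U P" "0 \<le> s" "s < r" "r \<le> T"
  shows "U s $ j < U r $ j \<Longrightarrow> \<exists>t\<in>{s<..r}. dual_slack A \<gamma> c P (T - t) $ j = 0"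
    and "P s $ k < P r $ k \<Longrightarrow> \<exists>t\<in>{s<..r}. primal_slack A \<beta> b U (T - t) $ k = 0"
  using assms unfolding complementary_def by blast+

text \<open>By the symmetry of the convolution, the integrals of the dual slacks against \<open>dU\<close> and of the
primal slacks against \<open>dP\<close> add up to the duality gap. All of them are nonnegative, so each
vanishes when the gap does.\<close>

lemma complementary_slackness:
  fixes A :: "real ^ 'j ^ 'k"
  assumes T: "0 < T"
    and U: "mclp_feasible T A \<beta> b U" and P: "mclp_dual_feasible T A \<gamma> c P"
    and gap: "mclp_value T \<gamma> c U = mclp_dual_value T \<beta> b P"
  shows "complementary T A \<beta> b \<gamma> c U P"
proof -
  let ?M = "\<lambda>j. interval_measure (stieltjes_extension T (\<lambda>s. U s $ j))"
  let ?N = "\<lambda>k. interval_measure (stieltjes_extension T (\<lambda>s. P s $ k))"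
  have aU: "admissible T U" and aP: "admissible T P"
    using U P by (auto simp: mclp_feasible_def mclp_dual_feasible_def)
  note u = increasing_rcont_component[OF aU] and p = increasing_rcont_component[OF aP]
  define q where "q = (\<lambda>j t. dual_slack A \<gamma> c P (T - t) $ j)"
  define x where "x = (\<lambda>k t. primal_slack A \<beta> b U (T - t) $ k)"
  have q_eq: "q j = (\<lambda>t. column j A \<bullet> P (T - t) - (\<gamma> $ j + (T - t) * c $ j))" for j
    by (auto simp: q_def dual_slack_def matrix_vector_mult_def transpose_def column_def inner_vec_def)
  have x_eq: "x k = (\<lambda>t. (- row k A) \<bullet> U (T - t) - (- \<beta> $ k + (T - t) * - b $ k))" for k
    by (auto simp: x_def primal_slack_def matrix_vector_mult_def row_def inner_vec_def sum_negf)
  have q_int: "set_integrable (?M j) {0..T} (q j)" for j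
    unfolding q_eq by (rule slack_set_integrable[OF u aP T])
  have x_int: "set_integrable (?N k) {0..T} (x k)" for k
    unfolding x_eq by (rule slack_set_integrable[OF p aU T])
  have q_nonneg: "0 \<le> q j t" if "t \<in> {0..T}" for j t
    using P that by (auto simp: q_def dual_slack_def mclp_dual_feasible_def less_eq_vec_def)
  have x_nonneg: "0 \<le> x k t" if "t \<in> {0..T}" for k t
    using U that by (auto simp: x_def primal_slack_def mclp_feasible_def less_eq_vec_def)
  have "(\<Sum>j\<in>UNIV. LINT t:{0..T}|?M j. q j t)
      = (\<Sum>j\<in>UNIV. \<Sum>k\<in>UNIV. A $ k $ j * (LINT t:{0..T}|?M j. P (T - t) $ k)) - mclp_value T \<gamma> c U"
    unfolding q_eq slack_set_integrable(2)[OF u aP T] mclp_value_def stieltjes_integral_def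
    by (simp add: sum_subtractf column_def)
  moreover have "(\<Sum>k\<in>UNIV. LINT t:{0..T}|?N k. x k t)
      = mclp_dual_value T \<beta> b P - (\<Sum>k\<in>UNIV. \<Sum>j\<in>UNIV. A $ k $ j * (LINT t:{0..T}|?N k. U (T - t) $ j))"
  proof -
    have "(LINT t:{0..T}|?N k. - \<beta> $ k + (T - t) * - b $ k)
        = - (LINT t:{0..T}|?N k. (\<beta> + (T - t) *\<^sub>R b) $ k)" for k
    proof -
      have "(LINT t:{0..T}|?N k. - \<beta> $ k + (T - t) * - b $ k)
          = (LINT t:{0..T}|?N k. - ((\<beta> + (T - t) *\<^sub>R b) $ k))"
        by (intro set_lebesgue_integral_cong) auto
      also have "\<dots> = - (LINT t:{0..T}|?N k. (\<beta> + (T - t) *\<^sub>R b) $ k)"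
        unfolding set_lebesgue_integral_def scaleR_minus_right by (rule Bochner_Integration.integral_minus)
      finally show ?thesis .
    qed
    then show ?thesis
      unfolding x_eq slack_set_integrable(2)[OF p aU T] mclp_dual_value_def stieltjes_integral_def
      by (simp add: sum_subtractf row_def sum_negf sum.distrib)
  qed
  moreover have "(\<Sum>j\<in>UNIV. \<Sum>k\<in>UNIV. A $ k $ j * (LINT t:{0..T}|?M j. P (T - t) $ k))
      = (\<Sum>k\<in>UNIV. \<Sum>j\<in>UNIV. A $ k $ j * (LINT t:{0..T}|?N k. U (T - t) $ j))"
    using stieltjes_convolution_commute[OF u p T] by (subst sum.swap) simp
  ultimately have total: "(\<Sum>j\<in>UNIV. LINT t:{0..T}|?M j. q j t) + (\<Sum>k\<in>UNIV. LINT t:{0..T}|?N k. x k t) = 0"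
    using gap by simp
  have q_ge: "0 \<le> (LINT t:{0..T}|?M j. q j t)" for j
    unfolding set_lebesgue_integral_def
    by (intro Bochner_Integration.integral_nonneg) (auto simp: indicator_def q_nonneg)
  have x_ge: "0 \<le> (LINT t:{0..T}|?N k. x k t)" for k
    unfolding set_lebesgue_integral_def
    by (intro Bochner_Integration.integral_nonneg) (auto simp: indicator_def x_nonneg)
  have "(\<Sum>j\<in>UNIV. LINT t:{0..T}|?M j. q j t) = 0" "(\<Sum>k\<in>UNIV. LINT t:{0..T}|?N k. x k t) = 0"
    using total sum_nonneg[of UNIV "\<lambda>j. LINT t:{0..T}|?M j. q j t"]
      sum_nonneg[of UNIV "\<lambda>k. LINT t:{0..T}|?N k. x k t"] q_ge x_ge by auto
  then have "(LINT t:{0..T}|?M j. q j t) = 0" "(LINT t:{0..T}|?N k. x k t) = 0" for j k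
    using q_ge x_ge by (simp_all add: sum_nonneg_eq_0_iff)
  then show ?thesis
    unfolding complementary_def q_def[symmetric] x_def[symmetric]
    using stieltjes_zero_at_increase[OF u T q_int q_nonneg]
      stieltjes_zero_at_increase[OF p T x_int x_nonneg]
    unfolding q_def x_def by blast
qed

section \<open>Chords and concavity\<close>

definition chord :: "real \<Rightarrow> real \<Rightarrow> (real \<Rightarrow> 'a::real_vector) \<Rightarrow> real \<Rightarrow> 'a" where
  "chord s r f t = f s + ((t - s) / (r - s)) *\<^sub>R (f r - f s)"

lemma chord_ends [simp]: "chord s r f s = f s" "s \<noteq> r \<Longrightarrow> chord s r f r = f r"
  by (auto simp: chord_def)

lemma chord_eq: "chord s r f = (\<lambda>t. (f s - (s / (r - s)) *\<^sub>R (f r - f s)) + t *\<^sub>R ((1 / (r - s)) *\<^sub>R (f r - f s)))"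
  by (auto simp: chord_def diff_divide_distrib scaleR_diff_left algebra_simps)

lemma chord_convex_combination:
  assumes "s < r"
  shows "chord s r f t = ((r - t) / (r - s)) *\<^sub>R f s + ((t - s) / (r - s)) *\<^sub>R f r"
proof -
  have *: "(r - t) / (r - s) = 1 - (t - s) / (r - s)"
    using assms by (simp add: field_simps)
  show ?thesis unfolding chord_def * by (simp add: scaleR_diff_left scaleR_diff_right)
qed

lemma chord_affine:
  assumes "s < r" "\<And>t. t \<in> {s..r} \<Longrightarrow> f t = w + t *\<^sub>R v" "t \<in> {s..r}"
  shows "chord s r f t = f t"
proof -
  have "f r - f s = (r - s) *\<^sub>R v"
    using assms(1,2) by (simp add: algebra_simps)
  then have "chord s r f t = f s + ((t - s) / (r - s) * (r - s)) *\<^sub>R v"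
    by (simp only: chord_def scaleR_scaleR)
  also have "\<dots> = f s + (t - s) *\<^sub>R v" using assms(1) by simp
  finally show ?thesis
    using assms by (simp add: algebra_simps)
qed

lemma continuous_on_chord: "continuous_on X (chord s r (f :: real \<Rightarrow> 'a::real_normed_vector))"
  unfolding chord_def by (cases "r = s") (auto intro!: continuous_intros)

lemma integral_chord:
  fixes f :: "real \<Rightarrow> real"
  assumes "s < r"
  shows "integral {s..r} (chord s r f) = (r - s) * (f s + f r) / 2"
proof -
  define k where "k = (f r - f s) / (r - s) / 2"
  have "chord s r f = (\<lambda>t. f s + 2 * (t - s) * k)"
    using assms by (auto simp: chord_def k_def field_simps)
  moreover have "((\<lambda>t. f s + 2 * (t - s) * k) has_integral
      (f s * r + (r - s)\<^sup>2 * k) - (f s * s + (s - s)\<^sup>2 * k)) {s..r}"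
    using assms
    by (intro fundamental_theorem_of_calculus)
      (auto simp: has_real_derivative_iff_has_vector_derivative[symmetric] intro!: derivative_eq_intros)
  ultimately have "integral {s..r} (chord s r f) = f s * (r - s) + (r - s) * ((r - s) * k)"
    by (simp add: integral_unique power2_eq_square algebra_simps)
  also have "(r - s) * k = (f r - f s) / 2"
  proof -
    have "r - s \<noteq> 0" using assms by simp
    then show ?thesis by (simp only: k_def times_divide_eq_right nonzero_mult_div_cancel_left not_False_eq_True)
  qed
  finally show ?thesis by (simp add: field_simps)
qed

text \<open>This is the inequality that optimality delivers; continuity and concavity are both derived
from it.\<close>

definition chord_dominating :: "real \<Rightarrow> real \<Rightarrow> (real \<Rightarrow> real) \<Rightarrow> bool" where
  "chord_dominating a b f \<longleftrightarrow>
     (\<forall>s r. a < s \<longrightarrow> s < r \<longrightarrow> r < b \<longrightarrow>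
        f integrable_on {s..r} \<and> integral {s..r} (chord s r f) \<le> integral {s..r} f)"

text \<open>Suppose \<open>f\<close> jumps from \<open>L\<close> to \<open>R = f x\<close>. Over \<open>[x - \<eta>, x + h]\<close> the integral of
\<open>f\<close> is about \<open>\<eta> L + h R\<close>, that of the chord about \<open>(\<eta> + h) (L + R) / 2\<close>, so the inequality
says \<open>(\<eta> - h) (R - L) \<le> 0\<close> up to a small error. Letting \<open>\<eta> - h\<close> take both signs gives \<open>R = L\<close>.\<close>

lemma chord_dominating_no_jump:
  assumes f: "chord_dominating a b f" and x: "a < x" "x < b"
    and left: "(f \<longlongrightarrow> L) (at_left x)" and right: "(f \<longlongrightarrow> f x) (at_right x)"
  shows "f x = L"
proof -
  have "\<bar>f x - L\<bar> \<le> 0 + e" if "0 < e" for e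
  proof -
    \<comment> \<open>With \<open>\<eta>\<close> and \<open>h\<close> equal to \<open>d / 2\<close> and \<open>d / 4\<close>, in either order, the bound \<open>key\<close> below reads \<open>\<bar>f x - L\<bar> \<le> 12 * \<epsilon>\<close>.\<close>
    define \<epsilon> where "\<epsilon> = e / 12"
    have \<epsilon>: "0 < \<epsilon>" using that by (simp add: \<epsilon>_def)
    have "\<forall>\<^sub>F t in at_left x. \<bar>f t - L\<bar> < \<epsilon>"
      using left \<epsilon> by (auto simp: tendsto_iff dist_real_def)
    then obtain p where p: "p < x" "\<And>t. p < t \<Longrightarrow> t < x \<Longrightarrow> \<bar>f t - L\<bar> < \<epsilon>"
      using x(1) by (auto simp: eventually_at_left)
    have "\<forall>\<^sub>F t in at_right x. \<bar>f t - f x\<bar> < \<epsilon>"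
      using right \<epsilon> by (auto simp: tendsto_iff dist_real_def)
    then obtain q where q: "x < q" "\<And>t. x < t \<Longrightarrow> t < q \<Longrightarrow> \<bar>f t - f x\<bar> < \<epsilon>"
      using x(2) by (auto simp: eventually_at_right)
    define d where "d = Min {x - p, q - x, x - a, b - x}"
    have d: "0 < d" "d \<le> x - p" "d \<le> q - x" "d \<le> x - a" "d \<le> b - x"
      using p(1) q(1) x by (auto simp: d_def)
    have key: "(\<eta> - h) * (f x - L) \<le> 4 * \<epsilon> * (\<eta> + h)" if "0 < \<eta>" "\<eta> < d" "0 < h" "h < d" for \<eta> h
    proof -
      let ?s = "x - \<eta>" and ?r = "x + h"
      have int: "f integrable_on {?s..?r}"
        and le: "integral {?s..?r} (chord ?s ?r f) \<le> integral {?s..?r} f"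
        using f that d unfolding chord_dominating_def by auto
      have ints: "f integrable_on {?s..x}" "f integrable_on {x..?r}"
        using that by (auto intro!: integrable_subinterval_real[OF int])
      have "integral {?s..x} f = integral {?s..x} (f(x := L))"
        by (intro integral_spike[of "{x}"]) auto
      also have "\<dots> \<le> integral {?s..x} (\<lambda>t. L + \<epsilon>)"
      proof (rule integral_le)
        show "f(x := L) integrable_on {?s..x}"
          by (rule integrable_spike[OF ints(1), of "{x}"]) auto
        show "(f(x := L)) t \<le> L + \<epsilon>" if "t \<in> {?s..x}" for t
          using p(2)[of t] that \<open>\<eta> < d\<close> d \<epsilon> by (auto simp: abs_less_iff)
      qed auto
      finally have 1: "integral {?s..x} f \<le> \<eta> * (L + \<epsilon>)" using that by simp
      have "integral {x..?r} f \<le> integral {x..?r} (\<lambda>t. f x + \<epsilon>)"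
      proof (rule integral_le)
        show "f t \<le> f x + \<epsilon>" if "t \<in> {x..?r}" for t
          using q(2)[of t] that \<open>h < d\<close> d \<epsilon> by (cases "t = x") (auto simp: abs_less_iff)
      qed (use ints in auto)
      then have 2: "integral {x..?r} f \<le> h * (f x + \<epsilon>)" using that by simp
      have "integral {?s..?r} f = integral {?s..x} f + integral {x..?r} f"
        using that by (intro Henstock_Kurzweil_Integration.integral_combine[symmetric] int) auto
      then have "(\<eta> + h) * (f ?s + f ?r) / 2 \<le> \<eta> * (L + \<epsilon>) + h * (f x + \<epsilon>)"
        using le 1 2 integral_chord[of ?s ?r f] that by (simp add: add.commute)
      moreover have "(\<eta> + h) * (L + f x - 2 * \<epsilon>) \<le> (\<eta> + h) * (f ?s + f ?r)"
        using p(2)[of ?s] q(2)[of ?r] that d by (intro mult_left_mono) (auto simp: abs_less_iff)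
      ultimately show ?thesis by (simp add: algebra_simps)
    qed
    have "d * (f x - L) \<le> d * (12 * \<epsilon>)" "d * (L - f x) \<le> d * (12 * \<epsilon>)"
      using key[of "d / 2" "d / 4"] key[of "d / 4" "d / 2"] d(1) by (auto simp: field_simps)
    then have "f x - L \<le> 12 * \<epsilon>" "L - f x \<le> 12 * \<epsilon>"
      using d(1) by auto
    then show ?thesis by (simp add: \<epsilon>_def abs_le_iff)
  qed
  then have "\<bar>f x - L\<bar> \<le> 0" by (rule field_le_epsilon)
  then show ?thesis by simp
qed

text \<open>If the graph of \<open>f\<close> passed below a chord, then on a maximal interval on which it does so its
own chord would be a piece of the given one, hence lie strictly above \<open>f\<close>
and have the larger integral.\<close>

lemma chord_dominating_concave:
  assumes f: "chord_dominating a b f" and cont: "continuous_on {a<..<b} f"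
  shows "concave_on {a<..<b} f"
proof
  fix u s r :: real
  assume u: "0 < u" "u < 1" and s: "s \<in> {a<..<b}" and r: "r \<in> {a<..<b}" and sr: "s < r"
  define m where "m = (1 - u) *\<^sub>R s + u *\<^sub>R r"
  have um: "u * (r - s) = m - s" by (simp add: m_def algebra_simps)
  have m: "s < m" "m < r"
  proof -
    have "0 < u * (r - s)" "u * (r - s) < r - s"
      using u sr by auto
    then show "s < m" "m < r" unfolding um by simp_all
  qed
  define g where "g = (\<lambda>t. f t - chord s r f t)"
  have contg: "continuous_on {s..r} g"
    using s r unfolding g_def
    by (intro continuous_on_diff continuous_on_chord continuous_on_subset[OF cont]) auto
  have "0 \<le> g m"
  proof (rule ccontr)
    assume neg: "\<not> 0 \<le> g m"
    let ?L = "{t \<in> {s..m}. 0 \<le> g t}" and ?R = "{t \<in> {m..r}. 0 \<le> g t}"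
    have "compact {t \<in> {p..q}. 0 \<le> g t}" if "{p..q} \<subseteq> {s..r}" for p q
    proof -
      have "closed ({p..q} \<inter> g -` {0..})"
        by (intro continuous_closed_preimage continuous_on_subset[OF contg that]) auto
      moreover have "{p..q} \<inter> g -` {0..} = {t \<in> {p..q}. 0 \<le> g t}" by auto
      ultimately show ?thesis
        by (auto simp: compact_eq_bounded_closed intro: bounded_subset[OF bounded_closed_interval[of p q]])
    qed
    then have "compact ?L" "compact ?R" using m by auto
    then obtain s' r' where s': "s' \<in> ?L" "\<And>t. t \<in> ?L \<Longrightarrow> t \<le> s'" and r': "r' \<in> ?R" "\<And>t. t \<in> ?R \<Longrightarrow> r' \<le> t"
    proof -
      have ne: "s \<in> ?L" "r \<in> ?R" using m sr by (auto simp: g_def)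
      then have "?L \<noteq> {}" "?R \<noteq> {}" by blast+
      then show ?thesis
        using compact_attains_sup[OF \<open>compact ?L\<close>] compact_attains_inf[OF \<open>compact ?R\<close>] that by blast
    qed
    have *: "s' < m" "m < r'"
      using s' r' neg by (auto simp: order.strict_iff_order)
    have inside: "g t < 0" if "s' < t" "t < r'" for t
    proof (rule ccontr)
      assume "\<not> g t < 0"
      moreover have "s \<le> s'" "r' \<le> r" using s'(1) r'(1) by auto
      ultimately have "t \<in> ?L \<or> t \<in> ?R" using that by auto
      then show False using s'(2)[of t] r'(2)[of t] that by linarith
    qed
    have "g s' = 0"
    proof (rule ccontr)
      assume "g s' \<noteq> 0"
      moreover have "continuous_on {s'..m} g" using s'(1) m by (intro continuous_on_subset[OF contg]) auto
      ultimately obtain t where t: "s' \<le> t" "t \<le> m" "g t = 0"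
        using IVT2'[of g m 0 s'] s'(1) neg by auto
      then have "t \<in> ?L" using s'(1) by simp
      then show False
        using \<open>g s' \<noteq> 0\<close> s'(2)[of t] t by simp
    qed
    moreover have "g r' = 0"
    proof (rule ccontr)
      assume "g r' \<noteq> 0"
      moreover have "continuous_on {m..r'} g" using r'(1) m by (intro continuous_on_subset[OF contg]) auto
      ultimately obtain t where t: "m \<le> t" "t \<le> r'" "g t = 0"
        using IVT'[of g m 0 r'] r'(1) neg by auto
      then have "t \<in> ?R" using r'(1) by simp
      then show False
        using \<open>g r' \<noteq> 0\<close> r'(2)[of t] t by simp
    qed
    ultimately have ends: "f s' = chord s r f s'" "f r' = chord s r f r'" by (auto simp: g_def)
    have same: "chord s' r' f t = chord s r f t" if "t \<in> {s'..r'}" for t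
    proof -
      have "chord s' r' f t = chord s' r' (chord s r f) t"
        unfolding chord_def[of s' r'] ends ..
      also have "\<dots> = chord s r f t"
        by (rule chord_affine[OF _ _ that], use * in simp, simp only: chord_eq[of s r f])
      finally show ?thesis .
    qed
    have "integral {s'..r'} f < integral {s'..r'} (chord s r f)"
    proof (rule integral_less_real)
      show "continuous_on {s'..r'} f"
        using s' r' s r by (intro continuous_on_subset[OF cont]) auto
    qed (use inside * in \<open>auto simp: g_def continuous_on_chord\<close>)
    also have "\<dots> = integral {s'..r'} (chord s' r' f)"
      by (intro integral_cong same[symmetric])
    also have "\<dots> \<le> integral {s'..r'} f"
      using f s' r' s r * unfolding chord_dominating_def by auto
    finally show False by simp
  qed
  moreover have "chord s r f m = (1 - u) * f s + u * f r"
  proof -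
    have "(m - s) / (r - s) = u" using sr by (simp add: um[symmetric])
    then show ?thesis by (simp add: chord_def algebra_simps)
  qed
  ultimately show "(1 - u) * f s + u * f r \<le> f ((1 - u) *\<^sub>R s + u *\<^sub>R r)"
    by (simp add: g_def m_def)
qed auto

section \<open>Piecewise linear functions and concave functions with finitely many slopes\<close>

lemma piecewise_linear_on_single:
  assumes "l < r" "\<And>t. t \<in> {l<..<r} \<Longrightarrow> f t = w + t *\<^sub>R v"
  shows "piecewise_linear_on l r f"
  unfolding piecewise_linear_on_def
  using assms by (intro exI[of _ 1] exI[of _ "\<lambda>i. if i = 0 then l else r"]) auto

lemma piecewise_linear_on_join:
  assumes "piecewise_linear_on l m f" "piecewise_linear_on m r f"
  shows "piecewise_linear_on l r f"
proof -
  obtain n1 \<tau>1 where 1: "\<tau>1 0 = l" "\<tau>1 n1 = m" "\<And>i. i < n1 \<Longrightarrow> \<tau>1 i < \<tau>1 (Suc i)"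
    "\<And>i. i < n1 \<Longrightarrow> \<exists>v w. \<forall>t\<in>{\<tau>1 i<..<\<tau>1 (Suc i)}. f t = w + t *\<^sub>R v"
    using assms(1) unfolding piecewise_linear_on_def by metis
  obtain n2 \<tau>2 where 2: "\<tau>2 0 = m" "\<tau>2 n2 = r" "\<And>i. i < n2 \<Longrightarrow> \<tau>2 i < \<tau>2 (Suc i)"
    "\<And>i. i < n2 \<Longrightarrow> \<exists>v w. \<forall>t\<in>{\<tau>2 i<..<\<tau>2 (Suc i)}. f t = w + t *\<^sub>R v"
    using assms(2) unfolding piecewise_linear_on_def by metis
  define \<tau> where "\<tau> i = (if i \<le> n1 then \<tau>1 i else \<tau>2 (i - n1))" for i
  have step: "(\<tau> i = \<tau>1 i \<and> \<tau> (Suc i) = \<tau>1 (Suc i) \<and> i < n1) \<or>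
      (\<tau> i = \<tau>2 (i - n1) \<and> \<tau> (Suc i) = \<tau>2 (Suc (i - n1)) \<and> i - n1 < n2)" if "i < n1 + n2" for i
    using that 1(2) 2(1) by (cases i n1 rule: linorder_cases) (auto simp: \<tau>_def Suc_diff_le)
  show ?thesis
    unfolding piecewise_linear_on_def
  proof (intro exI[of _ "n1 + n2"] exI[of _ \<tau>] conjI allI impI)
    show "\<tau> 0 = l" "\<tau> (n1 + n2) = r"
      using 1 2 by (auto simp: \<tau>_def)
    fix i assume "i < n1 + n2"
    then show "\<tau> i < \<tau> (Suc i)" "\<exists>v w. \<forall>t\<in>{\<tau> i<..<\<tau> (Suc i)}. f t = w + t *\<^sub>R v"
      using step[of i] 1(3,4)[of i] 2(3,4)[of "i - n1"] by auto
  qed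
qed

lemma piecewise_linear_on_finite_breaks:
  assumes "finite B" "l < r"
    and "\<And>p q. l \<le> p \<Longrightarrow> p < q \<Longrightarrow> q \<le> r \<Longrightarrow> {p<..<q} \<inter> B = {} \<Longrightarrow>
        \<exists>v w. \<forall>t\<in>{p<..<q}. f t = w + t *\<^sub>R v"
  shows "piecewise_linear_on l r f"
  using assms
proof (induction B arbitrary: l r rule: finite_psubset_induct)
  case (psubset B)
  show ?case
  proof (cases "{l<..<r} \<inter> B = {}")
    case True
    then show ?thesis
      using psubset.prems(2)[of l r] psubset.prems(1) piecewise_linear_on_single[of l r f] by auto
  next
    case False
    then obtain x where x: "x \<in> B" "l < x" "x < r" by auto
    have "B - {x} \<subset> B" using x by auto
    note IH = psubset.IH[OF this]
    have "piecewise_linear_on l x f"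
      using x by (intro IH psubset.prems(2)) auto
    moreover have "piecewise_linear_on x r f"
      using x by (intro IH psubset.prems(2)) auto
    ultimately show ?thesis by (rule piecewise_linear_on_join)
  qed
qed

lemma breakpoints_mono:
  fixes \<tau> :: "nat \<Rightarrow> real"
  assumes "\<And>i. i < n \<Longrightarrow> \<tau> i < \<tau> (Suc i)" "i \<le> j" "j \<le> n"
  shows "\<tau> i \<le> \<tau> j"
  using assms(2,3)
proof (induction j rule: dec_induct)
  case (step j)
  then show ?case using assms(1)[of j] by auto
qed simp

lemma breakpoint_interval:
  fixes \<tau> :: "nat \<Rightarrow> real"
  assumes "\<tau> 0 < x" "x \<le> \<tau> n"
  shows "\<exists>i<n. \<tau> i < x \<and> x \<le> \<tau> (Suc i)"
  using assms
proof (induction n)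
  case (Suc n)
  then show ?case by (cases "x \<le> \<tau> n") (auto simp: less_Suc_eq)
qed simp

lemma piecewise_linear_on_reverse:
  assumes "piecewise_linear_on 0 T P"
  shows "piecewise_linear_on 0 T (\<lambda>t. P (T - t))"
proof -
  obtain n \<tau> where \<tau>: "\<tau> 0 = 0" "\<tau> n = T" "\<And>i. i < n \<Longrightarrow> \<tau> i < \<tau> (Suc i)"
    and aff: "\<And>i. i < n \<Longrightarrow> \<exists>v w. \<forall>t\<in>{\<tau> i<..<\<tau> (Suc i)}. P t = w + t *\<^sub>R v"
    using assms unfolding piecewise_linear_on_def by metis
  show ?thesis
    unfolding piecewise_linear_on_def
  proof (intro exI[of _ n] exI[of _ "\<lambda>i. T - \<tau> (n - i)"] conjI allI impI)
    fix i assume i: "i < n"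
    define j where "j = n - Suc i"
    have j: "j < n" "n - i = Suc j" "n - Suc i = j" using i by (auto simp: j_def)
    show "T - \<tau> (n - i) < T - \<tau> (n - Suc i)" using \<tau>(3)[OF j(1)] j by simp
    obtain v w where wv: "\<forall>t\<in>{\<tau> j<..<\<tau> (Suc j)}. P t = w + t *\<^sub>R v" using aff[OF j(1)] by blast
    have "P (T - t) = (w + T *\<^sub>R v) + t *\<^sub>R (- v)" if "t \<in> {T - \<tau> (n - i)<..<T - \<tau> (n - Suc i)}" for t
      using bspec[OF wv, of "T - t"] that j by (auto simp: algebra_simps)
    then show "\<exists>v w. \<forall>t\<in>{T - \<tau> (n - i)<..<T - \<tau> (n - Suc i)}. P (T - t) = w + t *\<^sub>R v" by blast
  qed (use \<tau> in auto)
qed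

text \<open>The segment from a point of the interval towards \<open>s\<close> starts on the line; if \<open>f s\<close> were above
the line, concavity would lift \<open>f\<close> above it immediately, still inside the interval.\<close>

lemma concave_below_local_line:
  fixes f :: "real \<Rightarrow> real"
  assumes conc: "concave_on {a<..<b} f"
    and line: "\<And>t. p < t \<Longrightarrow> t < q \<Longrightarrow> f t = w + v * t" and pq: "a \<le> p" "p < q" "q \<le> b"
    and s: "a < s" "s < b"
  shows "f s \<le> w + v * s"
proof -
  define t where "t = (p + q) / 2"
  have t: "p < t" "t < q" using pq by (auto simp: t_def)
  \<comment> \<open>A weight small enough to keep \<open>(1 - u) * t + u * s\<close> inside \<open>{p<..<q}\<close>.\<close>
  define u where "u = min 1 ((q - t) / (2 * (\<bar>s - t\<bar> + 1)))"
  have u: "0 < u" "u \<le> 1" using t by (auto simp: u_def intro!: divide_pos_pos add_nonneg_pos)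
  have "u * \<bar>s - t\<bar> \<le> (q - t) / (2 * (\<bar>s - t\<bar> + 1)) * \<bar>s - t\<bar>"
    by (intro mult_right_mono) (auto simp: u_def)
  also have "\<dots> = (q - t) / 2 * (\<bar>s - t\<bar> / (\<bar>s - t\<bar> + 1))" by (simp add: field_simps)
  also have "\<dots> \<le> (q - t) / 2 * 1" using t by (intro mult_left_mono) auto
  also have "\<dots> < q - t" using t by simp
  also have "q - t = t - p" by (simp add: t_def field_simps)
  finally have "u * \<bar>s - t\<bar> < t - p" .
  then have small: "\<bar>u * (s - t)\<bar> < t - p" "t - p = q - t"
    using u by (simp add: abs_mult, simp add: t_def field_simps)
  have z: "(1 - u) * t + u * s = t + u * (s - t)" by (simp add: algebra_simps)
  have "(1 - u) * f t + u * f s \<le> f ((1 - u) * t + u * s)"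
    using concave_onD[OF conc, of u t s] u t pq s by auto
  also have "\<dots> = w + v * ((1 - u) * t + u * s)"
    unfolding z using small by (intro line) linarith+
  also have "\<dots> = (1 - u) * (w + v * t) + u * (w + v * s)" by (simp add: algebra_simps)
  finally have "u * f s \<le> u * (w + v * s)"
    using line[OF t] by simp
  then show ?thesis using u by simp
qed

lemma affine_order_constant:
  fixes w v w' v' :: real
  assumes m: "m \<in> {p<..<q}" "w + v * m \<le> w' + v' * m"
    and t: "t \<in> {p<..<q}"
    and no: "\<And>x. x \<in> {p<..<q} \<Longrightarrow> v \<noteq> v' \<Longrightarrow> w + v * x \<noteq> w' + v' * x"
  shows "w + v * t \<le> w' + v' * t"
proof (rule ccontr)
  assume neg: "\<not> ?thesis"
  then have "v \<noteq> v'" using m by auto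
  define d where "d x = (w' + v' * x) - (w + v * x)" for x
  have c: "continuous_on X d" for X unfolding d_def by (intro continuous_intros)
  have "\<exists>x\<in>{p<..<q}. d x = 0"
  proof (cases "m \<le> t")
    case True
    then show ?thesis using IVT2'[of d t 0 m] c neg m t by (fastforce simp: d_def)
  next
    case False
    then show ?thesis using IVT'[of d t 0 m] c neg m t by (fastforce simp: d_def)
  qed
  then obtain x where "x \<in> {p<..<q}" "d x = 0" by blast
  then show False using no[of x] \<open>v \<noteq> v'\<close> by (simp add: d_def)
qed

text \<open>The lines carrying \<open>f\<close> on small intervals support it from above, so each
slope occurs with a single intercept and there are finitely many lines; by density
\<open>f\<close> is their minimum. Breakpoints can occur only where two of the lines cross.\<close>

lemma concave_finitely_many_slopes:
  fixes f :: "real \<Rightarrow> real"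
  assumes ab: "a < b" and conc: "concave_on {a<..<b} f" and cont: "continuous_on {a<..<b} f"
    and F: "finite F"
    and dense: "\<And>p q. a \<le> p \<Longrightarrow> p < q \<Longrightarrow> q \<le> b \<Longrightarrow>
      \<exists>p' q' w. \<exists>v\<in>F. p \<le> p' \<and> p' < q' \<and> q' \<le> q \<and> (\<forall>t\<in>{p'<..<q'}. f t = w + v * t)"
  shows "piecewise_linear_on a b f"
proof -
  define \<Lambda> where "\<Lambda> = {(w, v). v \<in> F \<and> (\<exists>p q. a \<le> p \<and> p < q \<and> q \<le> b \<and> (\<forall>t\<in>{p<..<q}. f t = w + v * t))}"
  have above: "f t \<le> w + v * t" if "(w, v) \<in> \<Lambda>" "t \<in> {a<..<b}" for w v t
    using that concave_below_local_line[OF conc] by (fastforce simp: \<Lambda>_def)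
  have le: "w \<le> w'" if "(w, v) \<in> \<Lambda>" "(w', v) \<in> \<Lambda>" for w w' v
  proof -
    obtain p q where pq: "a \<le> p" "p < q" "q \<le> b" "\<forall>t\<in>{p<..<q}. f t = w + v * t"
      using \<open>(w, v) \<in> \<Lambda>\<close> unfolding \<Lambda>_def mem_Collect_eq case_prod_conv by blast
    have "(p + q) / 2 \<in> {p<..<q}" using pq by auto
    then show ?thesis using pq above[OF that(2), of "(p + q) / 2"] by force
  qed
  have "inj_on snd \<Lambda>"
    by (rule inj_onI) (metis antisym le prod.collapse)
  moreover have "snd ` \<Lambda> \<subseteq> F" by (auto simp: \<Lambda>_def)
  ultimately have fin: "finite \<Lambda>" using F inj_on_finite by blast
  have ne: "\<Lambda> \<noteq> {}"
    using dense[of a b] ab unfolding \<Lambda>_def by fastforce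
  \<comment> \<open>All crossing points; parallel lines contribute the harmless point \<open>0\<close>, since division by zero yields zero.\<close>
  define B where "B = (\<lambda>((w, v), (w', v')). (w' - w) / (v - v')) ` (\<Lambda> \<times> \<Lambda>)"
  show ?thesis
  proof (rule piecewise_linear_on_finite_breaks)
    show "finite B" using fin by (auto simp: B_def)
    fix p q assume pq: "a \<le> p" "p < q" "q \<le> b" and gap: "{p<..<q} \<inter> B = {}"
    define m where "m = (p + q) / 2"
    have m: "m \<in> {p<..<q}" using pq by (auto simp: m_def)
    obtain w v where wv: "(w, v) \<in> \<Lambda>" "\<And>w' v'. (w', v') \<in> \<Lambda> \<Longrightarrow> w + v * m \<le> w' + v' * m"
    proof -
      have "\<exists>x\<in>\<Lambda>. \<forall>y\<in>\<Lambda>. fst x + snd x * m \<le> fst y + snd y * m"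
        using fin ne arg_min_least[of \<Lambda> _ "\<lambda>x. fst x + snd x * m"] arg_min_if_finite(1)[of \<Lambda> "\<lambda>x. fst x + snd x * m"]
        by blast
      then show ?thesis using that by fastforce
    qed
    have low: "w + v * t \<le> w' + v' * t" if "(w', v') \<in> \<Lambda>" "t \<in> {p<..<q}" for w' v' t
    proof (rule affine_order_constant[OF m wv(2)[OF that(1)] that(2)])
      fix x assume x: "x \<in> {p<..<q}" "v \<noteq> v'"
      show "w + v * x \<noteq> w' + v' * x"
      proof
        assume "w + v * x = w' + v' * x"
        then have "x = (w' - w) / (v - v')" using x(2) by (simp add: field_simps)
        then have "x \<in> B" using wv(1) that(1) by (force simp: B_def)
        then show False using gap x(1) by auto
      qed
    qed
    have "f t = w + v * t" if t: "t \<in> {p<..<q}" for t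
    proof (rule ccontr)
      assume "f t \<noteq> w + v * t"
      moreover have "continuous_on {p<..<q} (\<lambda>x. f x - (w + v * x))"
        using pq by (intro continuous_intros continuous_on_subset[OF cont]) auto
      ultimately obtain e where e: "0 < e" "\<And>y. dist t y < e \<Longrightarrow> y \<in> {p<..<q} \<Longrightarrow> f y - (w + v * y) \<noteq> 0"
        using continuous_on_open_avoid[of "{p<..<q}" "\<lambda>x. f x - (w + v * x)" t 0] t by auto
      obtain p' q' w' v' where sub: "v' \<in> F" "max p (t - e) \<le> p'" "p' < q'" "q' \<le> min q (t + e)"
        "\<forall>t\<in>{p'<..<q'}. f t = w' + v' * t"
      proof -
        have "a \<le> max p (t - e)" "max p (t - e) < min q (t + e)" "min q (t + e) \<le> b"
          using e(1) t pq by auto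
        from dense[OF this] that show ?thesis by blast
      qed
      define y where "y = (p' + q') / 2"
      have y: "y \<in> {p'<..<q'}" "y \<in> {p<..<q}" "dist t y < e"
      proof -
        show "y \<in> {p'<..<q'}" using sub(3) by (simp add: y_def)
        then show "y \<in> {p<..<q}" "dist t y < e"
          using sub(2,4) by (auto simp: dist_real_def abs_less_iff)
      qed
      have "(w', v') \<in> \<Lambda>"
        unfolding \<Lambda>_def mem_Collect_eq case_prod_conv
        by (intro conjI exI[of _ p'] exI[of _ q']) (use sub pq in auto)
      then have "w + v * y \<le> f y" using low[of w' v' y] sub y by auto
      moreover have "f y \<le> w + v * y" using above[OF wv(1)] y pq by auto
      ultimately show False using e(2)[of y] y by auto
    qed
    then have "\<forall>t\<in>{p<..<q}. f t = w + t *\<^sub>R v" by (simp add: mult.commute)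
    then show "\<exists>v w. \<forall>t\<in>{p<..<q}. f t = w + t *\<^sub>R v" by blast
  qed (rule ab)
qed

section \<open>Replacing a feasible solution by a chord\<close>

lemma linear_chord:
  assumes "linear h"
  shows "h (chord s r f t) = chord s r (\<lambda>t. h (f t)) t"
  using assms by (simp add: chord_def linear_add linear_scale linear_diff)

lemma chord_component: "chord s r f t $ i = chord s r (\<lambda>t. f t $ i) t"
  by (simp add: chord_def)

lemma chord_mono:
  fixes f g :: "real \<Rightarrow> real"
  assumes "s < r" "t \<in> {s..r}" "f s \<le> g s" "f r \<le> g r"
  shows "chord s r f t \<le> chord s r g t"
proof -
  have "0 \<le> (r - t) / (r - s)" "0 \<le> (t - s) / (r - s)" using assms by auto
  then show ?thesis
    unfolding chord_convex_combination[OF assms(1)] real_scaleR_def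
    using assms by (intro add_mono mult_left_mono)
qed

definition chord_replace :: "real \<Rightarrow> real \<Rightarrow> (real \<Rightarrow> 'a::real_vector) \<Rightarrow> real \<Rightarrow> 'a" where
  "chord_replace s r f t = (if t \<in> {s..r} then chord s r f t else f t)"

lemma chord_replace_component: "chord_replace s r f t $ i = chord_replace s r (\<lambda>t. f t $ i) t"
  by (simp add: chord_replace_def chord_component)

lemma linear_chord_replace:
  "linear h \<Longrightarrow> h (chord_replace s r f t) = chord_replace s r (\<lambda>t. h (f t)) t"
  by (simp add: chord_replace_def linear_chord)

lemma chord_replace_at [simp]: "s < r \<Longrightarrow> t \<notin> {s<..<r} \<Longrightarrow> chord_replace s r f t = f t"
  by (auto simp: chord_replace_def not_less intro: antisym)

lemma mono_on_chord_replace: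
  fixes u :: "real \<Rightarrow> real"
  assumes u: "mono_on {0..T} u" and sr: "0 \<le> s" "s < r" "r \<le> T"
  shows "mono_on {0..T} (chord_replace s r u)"
proof (rule mono_onI)
  fix x y assume x: "x \<in> {0..T}" and y: "y \<in> {0..T}" and "x \<le> y"
  have "u s \<le> u r" using u sr by (auto simp: mono_on_def)
  then have *: "chord s r u p \<le> chord s r u q" if "p \<le> q" for p q
    using sr that by (auto simp: chord_def intro!: mult_right_mono divide_right_mono)
  have b: "u s \<le> chord s r u t" "chord s r u t \<le> u r" if "t \<in> {s..r}" for t
    using *[of s t] *[of t r] that sr by auto
  have m: "u p \<le> u q" if "p \<in> {0..T}" "q \<in> {0..T}" "p \<le> q" for p q
    using u that by (auto simp: mono_on_def)
  show "chord_replace s r u x \<le> chord_replace s r u y"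
    using x y sr \<open>x \<le> y\<close> *[of x y] b[of x] b[of y] m[of x y] m[of x s] m[of r y]
    by (auto simp: chord_replace_def intro: order_trans)
qed

lemma increasing_rcont_chord_replace:
  assumes u: "increasing_rcont T u" and sr: "0 \<le> s" "s < r" "r \<le> T"
  shows "increasing_rcont T (chord_replace s r u)"
  unfolding increasing_rcont_def
proof (intro conjI ballI)
  have mono: "mono_on {0..T} (chord_replace s r u)"
    using u sr by (intro mono_on_chord_replace) (auto simp: increasing_rcont_def)
  then show "mono_on {0..T} (chord_replace s r u)" .
  fix t assume t: "t \<in> {0..T}"
  have "0 \<le> chord_replace s r u 0" using u sr by (auto simp: increasing_rcont_def)
  also have "\<dots> \<le> chord_replace s r u t" using mono t by (auto simp: mono_on_def)
  finally show "0 \<le> chord_replace s r u t" .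
next
  fix t assume t: "t \<in> {0..<T}"
  have ut: "(u \<longlongrightarrow> u t) (at_right t)"
    using u t by (auto simp: increasing_rcont_def continuous_within)
  consider "t < s" | "s \<le> t" "t < r" | "r \<le> t" by linarith
  then show "continuous (at_right t) (chord_replace s r u)"
  proof cases
    case 1
    have "\<forall>\<^sub>F x in at_right t. u x = chord_replace s r u x"
      using eventually_at_right[OF 1] 1 sr by (auto intro!: exI[of _ s])
    then show ?thesis
      using 1 sr ut by (auto simp: continuous_within intro: Lim_transform_eventually)
  next
    case 2
    have "\<forall>\<^sub>F x in at_right t. chord s r u x = chord_replace s r u x"
      using eventually_at_right[OF 2(2)] 2 by (auto simp: chord_replace_def intro!: exI[of _ r])
    moreover have "(chord s r u \<longlongrightarrow> chord s r u t) (at_right t)"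
      using continuous_on_chord[of UNIV s r u] tendsto_within_subset[of "chord s r u" _ t UNIV]
      by (auto simp: continuous_on_def)
    ultimately show ?thesis
      using 2 by (auto simp: continuous_within chord_replace_def intro: Lim_transform_eventually)
  next
    case 3
    have "\<forall>\<^sub>F x in at_right t. u x = chord_replace s r u x"
      using eventually_at_right[of t "t + 1"] 3 sr by (auto intro!: exI[of _ "t + 1"])
    then show ?thesis
      using 3 sr ut by (auto simp: continuous_within intro: Lim_transform_eventually)
  qed
qed

text \<open>Feasibility survives because the right-hand side \<open>\<beta> + t *\<^sub>R b\<close> is its own chord.\<close>

lemma mclp_feasible_chord_replace:
  assumes U: "mclp_feasible T A \<beta> b U" and sr: "0 \<le> s" "s < r" "r \<le> T"
  shows "mclp_feasible T A \<beta> b (chord_replace s r U)"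
proof -
  have "admissible T (chord_replace s r U)"
    using U sr unfolding mclp_feasible_def admissible_iff_components chord_replace_component
    by (auto intro: increasing_rcont_chord_replace)
  moreover have "A *v chord_replace s r U t \<le> \<beta> + t *\<^sub>R b" if t: "t \<in> {0..T}" for t
    unfolding less_eq_vec_def
  proof
    fix k
    have f: "(A *v U t) $ k \<le> \<beta> $ k + t * b $ k" if "t \<in> {0..T}" for t
      using U that by (auto simp: mclp_feasible_def less_eq_vec_def)
    have "(A *v chord_replace s r U t) $ k = chord_replace s r (\<lambda>t. (A *v U t) $ k) t"
      by (simp add: linear_chord_replace[OF matrix_vector_mul_linear] chord_replace_component)
    also have "\<dots> \<le> \<beta> $ k + t * b $ k"
    proof (cases "t \<in> {s..r}")
      case True
      have "chord s r (\<lambda>t. (A *v U t) $ k) t \<le> chord s r (\<lambda>t. \<beta> $ k + t * b $ k) t"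
        using sr True by (intro chord_mono f) auto
      also have "\<dots> = \<beta> $ k + t * b $ k"
        using sr True by (intro chord_affine[where w = "\<beta> $ k" and v = "b $ k"]) auto
      finally show ?thesis using True by (simp add: chord_replace_def)
    next
      case False
      then show ?thesis using f[OF t] by (auto simp: chord_replace_def)
    qed
    finally show "(A *v chord_replace s r U t) $ k \<le> (\<beta> + t *\<^sub>R b) $ k" by simp
  qed
  ultimately show ?thesis by (simp add: mclp_feasible_def)
qed

lemma admissible_inner_integrable:
  assumes "admissible T U"
  shows "(\<lambda>t. c \<bullet> U t) integrable_on {0..T}"
  unfolding inner_vec_def inner_real_def
  using increasing_rcont_integrable[OF increasing_rcont_component[OF assms]]
  by (auto intro!: integrable_sum integrable_on_mult_right)

lemma integral_chord_replace:
  fixes f :: "real \<Rightarrow> real"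
  assumes f: "f integrable_on {0..T}" and sr: "0 \<le> s" "s < r" "r \<le> T"
    and g: "chord_replace s r f integrable_on {0..T}"
  shows "integral {0..T} (chord_replace s r f)
    = integral {0..T} f - integral {s..r} f + integral {s..r} (chord s r f)"
proof -
  have split: "integral {0..T} h = integral {0..s} h + integral {s..r} h + integral {r..T} h"
    if "h integrable_on {0..T}" for h :: "real \<Rightarrow> real"
  proof -
    have "integral {0..T} h = integral {0..r} h + integral {r..T} h"
      using sr by (intro Henstock_Kurzweil_Integration.integral_combine[symmetric] that) auto
    moreover have "integral {0..r} h = integral {0..s} h + integral {s..r} h"
      using sr by (intro Henstock_Kurzweil_Integration.integral_combine[symmetric]
          integrable_subinterval_real[OF that]) auto
    ultimately show ?thesis by simp
  qed
  have "integral {0..s} (chord_replace s r f) = integral {0..s} f"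
    "integral {r..T} (chord_replace s r f) = integral {r..T} f"
    "integral {s..r} (chord_replace s r f) = integral {s..r} (chord s r f)"
    using sr by (auto intro!: integral_cong simp: chord_replace_def[of s r f])
  then show ?thesis using split[OF f] split[OF g] by simp
qed

text \<open>The chord keeps the value at \<open>T\<close>, so the objective changes only by the difference of the two
integrals.\<close>

lemma mclp_optimal_chord_integral:
  assumes T: "0 < T" and U: "mclp_optimal T A \<beta> b \<gamma> c U" and sr: "0 \<le> s" "s < r" "r \<le> T"
  shows "integral {s..r} (chord s r (\<lambda>t. c \<bullet> U t)) \<le> integral {s..r} (\<lambda>t. c \<bullet> U t)"
proof -
  let ?V = "chord_replace s r U"
  have fU: "mclp_feasible T A \<beta> b U" using U by (simp add: mclp_optimal_def)
  have fV: "mclp_feasible T A \<beta> b ?V" by (rule mclp_feasible_chord_replace[OF fU sr])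
  have aU: "admissible T U" and aV: "admissible T ?V"
    using fU fV by (auto simp: mclp_feasible_def)
  have V: "(\<lambda>t. c \<bullet> ?V t) = chord_replace s r (\<lambda>t. c \<bullet> U t)"
    by (intro ext linear_chord_replace bounded_linear.linear bounded_linear_inner_right)
  have "mclp_value T \<gamma> c ?V \<le> mclp_value T \<gamma> c U"
    using U fV by (simp add: mclp_optimal_def)
  then have "integral {0..T} (chord_replace s r (\<lambda>t. c \<bullet> U t)) \<le> integral {0..T} (\<lambda>t. c \<bullet> U t)"
    using sr unfolding mclp_value_eq[OF aU T] mclp_value_eq[OF aV T] V by simp
  then show ?thesis
    using integral_chord_replace[OF admissible_inner_integrable[OF aU] sr]
      admissible_inner_integrable[OF aV, of c, unfolded V] by simp
qed

text \<open>One-sided limits are kept together with the order bounds, which are what the feasibility and sign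
arguments at jumps need.\<close>

lemma increasing_left_limit:
  fixes u :: "real \<Rightarrow> real"
  assumes u: "mono_on {0..T} u" and x: "0 < x" "x \<le> T"
  shows "\<exists>L. (u \<longlongrightarrow> L) (at_left x) \<and> (\<forall>t\<in>{0..<x}. u t \<le> L) \<and> L \<le> u x"
proof -
  define L where "L = (SUP t\<in>{0..<x}. u t)"
  have m: "u p \<le> u q" if "0 \<le> p" "p \<le> q" "q \<le> T" for p q
    using u that by (auto simp: mono_on_def)
  have bdd: "bdd_above (u ` {0..<x})"
    using m x by (intro bdd_aboveI[of _ "u x"]) auto
  have ub: "u t \<le> L" if "t \<in> {0..<x}" for t
    unfolding L_def using bdd that by (rule cSUP_upper2) simp
  have "L \<le> u x"
    unfolding L_def using x m by (intro cSUP_least) auto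
  moreover have "(u \<longlongrightarrow> L) (at_left x)"
  proof (rule order_tendstoI)
    fix a assume "a < L"
    then obtain p where p: "p \<in> {0..<x}" "a < u p"
      unfolding L_def using less_cSUP_iff[of "{0..<x}" u a] bdd x by auto
    then show "\<forall>\<^sub>F t in at_left x. a < u t"
      using m x by (auto simp: eventually_at_left[of p x] intro!: exI[of _ p] less_le_trans[OF p(2)])
  next
    fix a assume "L < a"
    then show "\<forall>\<^sub>F t in at_left x. u t < a"
      using ub x by (auto simp: eventually_at_left[of 0 x] intro!: exI[of _ 0] le_less_trans[OF ub])
  qed
  ultimately show ?thesis using ub by blast
qed

lemma admissible_left_limit:
  fixes U :: "real \<Rightarrow> real ^ 'n"
  assumes U: "admissible T U" and x: "0 < x" "x \<le> T"
  obtains L where "(U \<longlongrightarrow> L) (at_left x)" "\<And>t. t \<in> {0..<x} \<Longrightarrow> U t \<le> L" "L \<le> U x"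
proof -
  have "\<forall>i. \<exists>L. ((\<lambda>t. U t $ i) \<longlongrightarrow> L) (at_left x) \<and> (\<forall>t\<in>{0..<x}. U t $ i \<le> L) \<and> L \<le> U x $ i"
    using U x unfolding admissible_iff_components increasing_rcont_def
    by (auto intro!: increasing_left_limit)
  then obtain L where L: "\<And>i. ((\<lambda>t. U t $ i) \<longlongrightarrow> L i) (at_left x)"
    "\<And>i t. t \<in> {0..<x} \<Longrightarrow> U t $ i \<le> L i" "\<And>i. L i \<le> U x $ i"
    by metis
  show ?thesis
    by (rule that[of "vec_lambda L"]) (auto simp: less_eq_vec_def L intro!: vec_tendstoI)
qed

lemma admissible_right_tendsto:
  "admissible T U \<Longrightarrow> 0 \<le> x \<Longrightarrow> x < T \<Longrightarrow> (U \<longlongrightarrow> U x) (at_right x)"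
  by (simp add: admissible_def continuous_within)

text \<open>Monotonicity provides the one-sided limits, and the chord inequality rules out a jump in the
direction \<open>c\<close>; the solution \<open>U\<close> itself may still jump orthogonally to \<open>c\<close>.\<close>

lemma mclp_optimal_rate_concave:
  fixes c :: "real ^ 'j"
  assumes T: "0 < T" and U: "mclp_optimal T A \<beta> b \<gamma> c U"
  shows "continuous_on {0<..<T} (\<lambda>t. c \<bullet> U t)" and "concave_on {0<..<T} (\<lambda>t. c \<bullet> U t)"
proof -
  have aU: "admissible T U" using U by (simp add: mclp_optimal_def mclp_feasible_def)
  have dom: "chord_dominating 0 T (\<lambda>t. c \<bullet> U t)"
    unfolding chord_dominating_def
    using mclp_optimal_chord_integral[OF T U]
    by (auto intro!: integrable_subinterval_real[OF admissible_inner_integrable[OF aU]])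
  show cont: "continuous_on {0<..<T} (\<lambda>t. c \<bullet> U t)"
  proof (intro continuous_at_imp_continuous_on ballI)
    fix x assume x: "x \<in> {0<..<T}"
    obtain L where L: "(U \<longlongrightarrow> L) (at_left x)"
      using admissible_left_limit[OF aU, of x] x by auto
    have l: "((\<lambda>t. c \<bullet> U t) \<longlongrightarrow> c \<bullet> L) (at_left x)"
      and r: "((\<lambda>t. c \<bullet> U t) \<longlongrightarrow> c \<bullet> U x) (at_right x)"
      using L admissible_right_tendsto[OF aU, of x] x by (auto intro!: tendsto_inner)
    have "c \<bullet> U x = c \<bullet> L"
      using chord_dominating_no_jump[OF dom _ _ l r] x by auto
    then show "isCont (\<lambda>t. c \<bullet> U t) x"
      using l r by (simp add: isCont_def filterlim_at_split)
  qed
  show "concave_on {0<..<T} (\<lambda>t. c \<bullet> U t)"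
    by (rule chord_dominating_concave[OF dom cont])
qed

section \<open>The objective rate takes finitely many slopes\<close>

text \<open>Finitely many properties that can be attained on subintervals of every interval and pass to smaller
intervals can be attained simultaneously: shrink the interval once for each of them.\<close>

lemma common_subinterval:
  fixes Pr :: "'i \<Rightarrow> real \<Rightarrow> real \<Rightarrow> bool"
  assumes "finite I"
    and ex: "\<And>i p q. i \<in> I \<Longrightarrow> a \<le> p \<Longrightarrow> p < q \<Longrightarrow> q \<le> b \<Longrightarrow>
      \<exists>p' q'. p \<le> p' \<and> p' < q' \<and> q' \<le> q \<and> Pr i p' q'"
    and her: "\<And>i p q p' q'. i \<in> I \<Longrightarrow> Pr i p q \<Longrightarrow> p \<le> p' \<Longrightarrow> p' < q' \<Longrightarrow> q' \<le> q \<Longrightarrow> Pr i p' q'"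
    and pq: "a \<le> p" "p < q" "q \<le> b"
  shows "\<exists>p' q'. p \<le> p' \<and> p' < q' \<and> q' \<le> q \<and> (\<forall>i\<in>I. Pr i p' q')"
  using assms(1) ex her
proof (induction I rule: finite_induct)
  case empty
  then show ?case using pq by blast
next
  case (insert i I)
  have "\<exists>p' q'. p \<le> p' \<and> p' < q' \<and> q' \<le> q \<and> (\<forall>i\<in>I. Pr i p' q')"
    using insert.prems by (intro insert.IH) blast+
  then obtain p1 q1 where 1: "p \<le> p1" "p1 < q1" "q1 \<le> q" "\<forall>i\<in>I. Pr i p1 q1" by blast
  then obtain p2 q2 where 2: "p1 \<le> p2" "p2 < q2" "q2 \<le> q1" "Pr i p2 q2"
    using insert.prems(1)[of i p1 q1] pq by fastforce
  have "Pr j p2 q2" if "j \<in> I" for j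
    using insert.prems(2)[of j p1 q1 p2 q2] 1 2 that by blast
  then show ?case using 1 2 by (intro exI[of _ p2] exI[of _ q2]) auto
qed

text \<open>If \<open>f\<close> takes some value twice it is constant in between. Otherwise it is strictly
increasing, so the zeros of \<open>g\<close> are dense, and one-sided continuity makes \<open>g\<close> vanish.\<close>

lemma constant_or_zero_subinterval:
  fixes f g :: "real \<Rightarrow> real"
  assumes mono: "mono_on {0..T} f"
    and g: "\<And>t. 0 \<le> t \<Longrightarrow> t < T \<Longrightarrow> (g \<longlongrightarrow> g t) (at_right t)"
    and compl: "\<And>s r. 0 \<le> s \<Longrightarrow> s < r \<Longrightarrow> r \<le> T \<Longrightarrow> f s < f r \<Longrightarrow> \<exists>t\<in>{s<..r}. g (T - t) = 0"
    and pq: "0 \<le> p" "p < q" "q \<le> T"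
  shows "\<exists>p' q'. p \<le> p' \<and> p' < q' \<and> q' \<le> q \<and>
    (f constant_on {p'<..<q'} \<or> (\<forall>t\<in>{p'<..<q'}. g (T - t) = 0))"
proof (cases "\<exists>s r. p < s \<and> s < r \<and> r < q \<and> f s = f r")
  case True
  then obtain s r where sr: "p < s" "s < r" "r < q" "f s = f r" by blast
  have "f t = f s" if "t \<in> {s<..<r}" for t
    using mono_onD[OF mono, of s t] mono_onD[OF mono, of t r] sr pq that by auto
  then have "f constant_on {s<..<r}" by (auto simp: constant_on_def)
  then show ?thesis using sr by (intro exI[of _ s] exI[of _ r]) auto
next
  case False
  have zero: "\<exists>t\<in>{s<..r}. g (T - t) = 0" if "p < s" "s < r" "r < q" for s r
    using False mono_onD[OF mono, of s r] that pq by (intro compl) (auto simp: order.strict_iff_order)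
  have "g (T - t) = 0" if t: "t \<in> {p<..<q}" for t
  proof (rule ccontr)
    assume "g (T - t) \<noteq> 0"
    then have "\<forall>\<^sub>F y in at_right (T - t). g y \<noteq> 0"
      using g[of "T - t"] t pq by (auto intro: tendsto_imp_eventually_ne)
    then obtain y0 where y0: "T - t < y0" "\<And>y. T - t < y \<Longrightarrow> y < y0 \<Longrightarrow> g y \<noteq> 0"
      by (auto simp: eventually_at_right[of "T - t" "T - t + 1"])
    obtain s where s: "max p (T - y0) < s" "s < t"
      using dense[of "max p (T - y0)" t] y0(1) t by auto
    obtain r where r: "s < r" "r < t" using dense[OF s(2)] by auto
    obtain z where "z \<in> {s<..r}" "g (T - z) = 0" using zero[of s r] s r t by auto
    then show False using y0(2)[of "T - z"] s r by auto
  qed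
  then show ?thesis using pq by blast
qed

lemma primal_slack_right_tendsto:
  fixes A :: "real ^ 'j ^ 'k"
  assumes "admissible T U" "0 \<le> t" "t < T"
  shows "((\<lambda>t. primal_slack A \<beta> b U t $ k) \<longlongrightarrow> primal_slack A \<beta> b U t $ k) (at_right t)"
  unfolding primal_slack_def
  by (intro tendsto_vec_nth tendsto_intros admissible_right_tendsto[OF assms]
      bounded_linear.tendsto[OF matrix_vector_mul_bounded_linear])

lemma dual_slack_right_tendsto:
  fixes A :: "real ^ 'j ^ 'k"
  assumes "admissible T P" "0 \<le> t" "t < T"
  shows "((\<lambda>t. dual_slack A \<gamma> c P t $ j) \<longlongrightarrow> dual_slack A \<gamma> c P t $ j) (at_right t)"
  unfolding dual_slack_def
  by (intro tendsto_vec_nth tendsto_intros admissible_right_tendsto[OF assms]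
      bounded_linear.tendsto[OF matrix_vector_mul_bounded_linear])

text \<open>\<open>J\<close> and \<open>K\<close> collect the components whose opposite slack vanishes identically on the
interval; the remaining components of \<open>U\<close> and \<open>P\<close> do not move there. Only finitely many
pairs \<open>(J, K)\<close> exist.\<close>

definition activity_pattern where
  "activity_pattern T A \<beta> b \<gamma> c U P J K p q \<longleftrightarrow>
     (\<forall>j\<in>J. \<forall>t\<in>{p<..<q}. dual_slack A \<gamma> c P (T - t) $ j = 0) \<and>
     (\<forall>j. j \<notin> J \<longrightarrow> (\<lambda>t. U t $ j) constant_on {p<..<q}) \<and>
     (\<forall>k\<in>K. \<forall>t\<in>{p<..<q}. primal_slack A \<beta> b U t $ k = 0) \<and>
     (\<forall>k. k \<notin> K \<longrightarrow> (\<lambda>t. P (T - t) $ k) constant_on {p<..<q})"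

lemma activity_pattern_subinterval:
  fixes A :: "real ^ 'j ^ 'k"
  assumes U: "admissible T U" and P: "admissible T P"
    and compl: "complementary T A \<beta> b \<gamma> c U P"
    and pq: "0 \<le> p" "p < q" "q \<le> T"
  shows "\<exists>p' q' J K. p \<le> p' \<and> p' < q' \<and> q' \<le> q \<and> activity_pattern T A \<beta> b \<gamma> c U P J K p' q'"
proof -
  define Q where "Q = (\<lambda>j p q. (\<lambda>t. U t $ j) constant_on {p<..<q} \<or>
    (\<forall>t\<in>{p<..<q}. dual_slack A \<gamma> c P (T - t) $ j = 0))"
  define X where "X = (\<lambda>k p q. (\<lambda>t. P (T - t) $ k) constant_on {p<..<q} \<or>
    (\<forall>t\<in>{p<..<q}. primal_slack A \<beta> b U t $ k = 0))"
  define Pr where "Pr = case_sum Q X"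
  have "\<exists>p' q'. p \<le> p' \<and> p' < q' \<and> q' \<le> q \<and> (\<forall>i\<in>UNIV. Pr i p' q')"
  proof (rule common_subinterval[OF _ _ _ pq])
    fix i :: "'j + 'k" and p q :: real assume pq: "0 \<le> p" "p < q" "q \<le> T"
    show "\<exists>p' q'. p \<le> p' \<and> p' < q' \<and> q' \<le> q \<and> Pr i p' q'"
    proof (cases i)
      case (Inl j)
      have "\<exists>p' q'. p \<le> p' \<and> p' < q' \<and> q' \<le> q \<and> Q j p' q'"
        unfolding Q_def
      proof (rule constant_or_zero_subinterval[OF _ _ _ pq])
        show "mono_on {0..T} (\<lambda>t. U t $ j)"
          using increasing_rcont_component[OF U, of j] by (simp add: increasing_rcont_def)
      qed (use complementaryD(1)[OF compl] in \<open>auto intro: dual_slack_right_tendsto[OF P]\<close>)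
      then show ?thesis by (simp add: Inl Pr_def)
    next
      case (Inr k)
      have "\<exists>p' q'. T - q \<le> p' \<and> p' < q' \<and> q' \<le> T - p \<and>
        ((\<lambda>t. P t $ k) constant_on {p'<..<q'} \<or> (\<forall>t\<in>{p'<..<q'}. primal_slack A \<beta> b U (T - t) $ k = 0))"
      proof (rule constant_or_zero_subinterval)
        show "mono_on {0..T} (\<lambda>t. P t $ k)"
          using increasing_rcont_component[OF P, of k] by (simp add: increasing_rcont_def)
      qed (use pq complementaryD(2)[OF compl] in \<open>auto intro: primal_slack_right_tendsto[OF U]\<close>)
      then obtain p' q' where *: "T - q \<le> p'" "p' < q'" "q' \<le> T - p"
        "(\<lambda>t. P t $ k) constant_on {p'<..<q'} \<or> (\<forall>t\<in>{p'<..<q'}. primal_slack A \<beta> b U (T - t) $ k = 0)"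
        by blast
      have "X k (T - q') (T - p')"
        using *(4)
      proof
        assume "(\<lambda>t. P t $ k) constant_on {p'<..<q'}"
        then have "(\<lambda>t. P (T - t) $ k) constant_on {T - q'<..<T - p'}"
          unfolding constant_on_def by fastforce
        then show ?thesis by (simp add: X_def)
      next
        assume z: "\<forall>t\<in>{p'<..<q'}. primal_slack A \<beta> b U (T - t) $ k = 0"
        have "primal_slack A \<beta> b U t $ k = 0" if "t \<in> {T - q'<..<T - p'}" for t
          using bspec[OF z, of "T - t"] that by auto
        then show ?thesis by (simp add: X_def)
      qed
      then show ?thesis
        using * by (intro exI[of _ "T - q'"] exI[of _ "T - p'"]) (auto simp: Inr Pr_def)
    qed
  next
    fix i :: "'j + 'k" and p q p' q' :: real
    assume "Pr i p q" "p \<le> p'" "p' < q'" "q' \<le> q"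
    then have "{p'<..<q'} \<subseteq> {p<..<q}" by auto
    with \<open>Pr i p q\<close> show "Pr i p' q'"
      by (cases i) (auto simp: Pr_def Q_def X_def intro: constant_on_subset)
  qed auto
  then obtain p' q' where *: "p \<le> p'" "p' < q'" "q' \<le> q" "\<And>i. Pr i p' q'" by blast
  have "activity_pattern T A \<beta> b \<gamma> c U P
      {j. \<forall>t\<in>{p'<..<q'}. dual_slack A \<gamma> c P (T - t) $ j = 0}
      {k. \<forall>t\<in>{p'<..<q'}. primal_slack A \<beta> b U t $ k = 0} p' q'"
    using *(4)[of "Inl _"] *(4)[of "Inr _"] by (auto simp: activity_pattern_def Pr_def Q_def X_def)
  then show ?thesis using * by blast
qed

text \<open>Comparing two intervals with the same pattern, the bilinear form
\<open>\<Delta>P \<bullet> (A *v \<Delta>U)\<close> can be evaluated from either side: in each component either the increment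
vanishes or the constraint is tight. Since the right-hand side involves the first interval
only through \<open>t1 - s1\<close>, the slope of \<open>c \<bullet> U\<close> depends on the pattern alone.\<close>

lemma activity_pattern_slope:
  fixes A :: "real ^ 'j ^ 'k"
  assumes 1: "activity_pattern T A \<beta> b \<gamma> c U P J K p1 q1" "s1 \<in> {p1<..<q1}" "t1 \<in> {p1<..<q1}"
    and 2: "activity_pattern T A \<beta> b \<gamma> c U P J K p2 q2" "s2 \<in> {p2<..<q2}" "t2 \<in> {p2<..<q2}"
  shows "(t2 - s2) * (c \<bullet> U t1 - c \<bullet> U s1) = (t1 - s1) * (b \<bullet> (P (T - s2) - P (T - t2)))"
proof -
  define \<Delta>U where "\<Delta>U = U t1 - U s1"
  define \<Delta>P where "\<Delta>P = P (T - s2) - P (T - t2)"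
  have dual: "(t2 - s2) * c $ j * \<Delta>U $ j = (transpose A *v \<Delta>P) $ j * \<Delta>U $ j" for j
  proof (cases "j \<in> J")
    case True
    then have "dual_slack A \<gamma> c P (T - s2) $ j = 0" "dual_slack A \<gamma> c P (T - t2) $ j = 0"
      using 2 by (auto simp: activity_pattern_def)
    then have "(transpose A *v \<Delta>P) $ j = (t2 - s2) * c $ j"
      by (simp add: dual_slack_def \<Delta>P_def matrix_vector_mult_diff_distrib algebra_simps)
    then show ?thesis by simp
  next
    case False
    then have "(\<lambda>t. U t $ j) constant_on {p1<..<q1}"
      using 1(1) by (simp add: activity_pattern_def)
    then have "\<Delta>U $ j = 0"
      using 1(2,3) by (auto simp: \<Delta>U_def constant_on_def)
    then show ?thesis by simp
  qed
  have primal: "\<Delta>P $ k * (A *v \<Delta>U) $ k = \<Delta>P $ k * ((t1 - s1) * b $ k)" for k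
  proof (cases "k \<in> K")
    case True
    then have "primal_slack A \<beta> b U s1 $ k = 0" "primal_slack A \<beta> b U t1 $ k = 0"
      using 1 by (auto simp: activity_pattern_def)
    then have "(A *v \<Delta>U) $ k = (t1 - s1) * b $ k"
      by (simp add: primal_slack_def \<Delta>U_def matrix_vector_mult_diff_distrib algebra_simps)
    then show ?thesis by simp
  next
    case False
    then have "(\<lambda>t. P (T - t) $ k) constant_on {p2<..<q2}"
      using 2(1) by (simp add: activity_pattern_def)
    then have "\<Delta>P $ k = 0"
      using 2(2,3) by (auto simp: \<Delta>P_def constant_on_def)
    then show ?thesis by simp
  qed
  have "(t2 - s2) * (c \<bullet> U t1 - c \<bullet> U s1) = (\<Sum>j\<in>UNIV. (t2 - s2) * c $ j * \<Delta>U $ j)"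
  proof -
    have "c \<bullet> U t1 - c \<bullet> U s1 = c \<bullet> \<Delta>U" by (simp add: \<Delta>U_def inner_diff_right)
    then show ?thesis by (simp add: inner_vec_def sum_distrib_left mult.assoc)
  qed
  also have "\<dots> = (transpose A *v \<Delta>P) \<bullet> \<Delta>U"
    by (simp add: dual inner_vec_def)
  also have "\<dots> = \<Delta>P \<bullet> (A *v \<Delta>U)"
    by (simp add: dot_lmul_matrix)
  also have "\<dots> = (\<Sum>k\<in>UNIV. \<Delta>P $ k * ((t1 - s1) * b $ k))"
    by (simp add: primal inner_vec_def)
  also have "\<dots> = (t1 - s1) * (b \<bullet> \<Delta>P)"
    by (simp add: inner_vec_def sum_distrib_left mult.commute mult.left_commute)
  finally show ?thesis by (simp add: \<Delta>P_def)
qed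

theorem mclp_optimal_rate_piecewise_linear:
  fixes A :: "real ^ 'j ^ 'k"
  assumes T: "0 < T" and U: "mclp_optimal T A \<beta> b \<gamma> c U" and P: "admissible T P"
    and compl: "complementary T A \<beta> b \<gamma> c U P"
  shows "piecewise_linear_on 0 T (\<lambda>t. c \<bullet> U t)"
proof -
  let ?pat = "activity_pattern T A \<beta> b \<gamma> c U P"
  have aU: "admissible T U" using U by (simp add: mclp_optimal_def mclp_feasible_def)
  define F where "F = (\<lambda>(J, K). {v. \<exists>p q w. p < q \<and> ?pat J K p q \<and> (\<forall>t\<in>{p<..<q}. c \<bullet> U t = w + v * t)})"
  have unique: "v1 = v2" if v1: "v1 \<in> F (J, K)" and v2: "v2 \<in> F (J, K)" for v1 v2 J K
  proof -
    obtain p1 q1 w1 where 1: "p1 < q1" "?pat J K p1 q1" "\<forall>t\<in>{p1<..<q1}. c \<bullet> U t = w1 + v1 * t"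
      using v1 by (auto simp: F_def)
    obtain p2 q2 w2 where 2: "p2 < q2" "?pat J K p2 q2" "\<forall>t\<in>{p2<..<q2}. c \<bullet> U t = w2 + v2 * t"
      using v2 by (auto simp: F_def)
    obtain t1 where t1: "p1 < t1" "t1 < q1" using dense[OF 1(1)] by blast
    obtain s1 where s1: "p1 < s1" "s1 < t1" using dense[OF t1(1)] by blast
    obtain t2 where t2: "p2 < t2" "t2 < q2" using dense[OF 2(1)] by blast
    obtain s2 where s2: "p2 < s2" "s2 < t2" using dense[OF t2(1)] by blast
    let ?\<psi> = "b \<bullet> (P (T - s2) - P (T - t2))"
    have "(t2 - s2) * ((t1 - s1) * v1) = (t1 - s1) * ?\<psi>"
      using activity_pattern_slope[OF 1(2) _ _ 2(2), of s1 t1 s2 t2] 1(3) s1 t1 s2 t2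
      by (simp add: algebra_simps)
    moreover have "(t2 - s2) * ((t2 - s2) * v2) = (t2 - s2) * ?\<psi>"
      using activity_pattern_slope[OF 2(2) _ _ 2(2), of s2 t2 s2 t2] 2(3) s1 t1 s2 t2
      by (simp add: algebra_simps)
    ultimately have "(t2 - s2) * v1 = ?\<psi>" "(t2 - s2) * v2 = ?\<psi>"
      using s1 s2 by (auto simp: mult.left_commute)
    then have "(t2 - s2) * v1 = (t2 - s2) * v2" by simp
    then show ?thesis using s2 by simp
  qed
  have "finite (F JK)" for JK
  proof (cases "F JK = {}")
    case False
    then obtain v where "v \<in> F JK" by blast
    then have "F JK \<subseteq> {v}" using unique by (cases JK) auto
    then show ?thesis by (rule finite_subset) simp
  qed simp
  then have fin: "finite (\<Union>JK. F JK)" by simp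
  show ?thesis
  proof (rule concave_finitely_many_slopes[OF T mclp_optimal_rate_concave(2,1)[OF T U] fin])
    fix p q :: real assume pq: "0 \<le> p" "p < q" "q \<le> T"
    obtain p' q' J K where sub: "p \<le> p'" "p' < q'" "q' \<le> q" and pat: "?pat J K p' q'"
      using activity_pattern_subinterval[OF aU P compl pq] by blast
    obtain t2 where t2: "p' < t2" "t2 < q'" using dense[OF sub(2)] by blast
    obtain s2 where s2: "p' < s2" "s2 < t2" using dense[OF t2(1)] by blast
    define v where "v = b \<bullet> (P (T - s2) - P (T - t2)) / (t2 - s2)"
    have line: "c \<bullet> U t = (c \<bullet> U s2 - v * s2) + v * t" if "t \<in> {p'<..<q'}" for t
    proof -
      have "(t2 - s2) * (c \<bullet> U t - c \<bullet> U s2) = (t - s2) * (b \<bullet> (P (T - s2) - P (T - t2)))"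
        using that s2 t2 by (intro activity_pattern_slope[OF pat _ _ pat]) auto
      then have "c \<bullet> U t - c \<bullet> U s2 = (t - s2) * v"
        using s2 by (simp add: v_def field_simps)
      then show ?thesis by (simp add: algebra_simps)
    qed
    have "\<exists>p q w. p < q \<and> ?pat J K p q \<and> (\<forall>t\<in>{p<..<q}. c \<bullet> U t = w + v * t)"
      using sub(2) pat line by blast
    then have "v \<in> F (J, K)" by (simp add: F_def)
    then show "\<exists>p' q' w. \<exists>v\<in>\<Union> (range F). p \<le> p' \<and> p' < q' \<and> q' \<le> q \<and> (\<forall>t\<in>{p'<..<q'}. c \<bullet> U t = w + v * t)"
      using sub line by blast
  qed
qed

section \<open>A continuous piecewise linear optimum\<close>

text \<open>The pieces of a piecewise linear function are only controlled on open intervals; one-sided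
continuity extends the formula to the ends.\<close>

lemma affine_closed_interval:
  fixes f :: "real \<Rightarrow> 'a::real_normed_vector"
  assumes pq: "p < q" and f: "\<And>t. t \<in> {p<..<q} \<Longrightarrow> f t = w + t *\<^sub>R v"
    and right: "(f \<longlongrightarrow> f p) (at_right p)" and left: "(f \<longlongrightarrow> f q) (at_left q)" and t: "t \<in> {p..q}"
  shows "f t = w + t *\<^sub>R v"
proof -
  let ?g = "\<lambda>t. w + t *\<^sub>R v"
  have g: "(?g \<longlongrightarrow> ?g x) (at x within S)" for x S by (intro tendsto_intros)
  have "\<forall>\<^sub>F x in at_right p. f x = ?g x" "\<forall>\<^sub>F x in at_left q. f x = ?g x"
    using pq f by (auto simp: eventually_at_right[OF pq] eventually_at_left[OF pq])
  then have "(?g \<longlongrightarrow> f p) (at_right p)" "(?g \<longlongrightarrow> f q) (at_left q)"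
    using left right by (auto intro: Lim_transform_eventually)
  then have "f p = ?g p" "f q = ?g q"
    using g tendsto_unique[of "at_right p" ?g] tendsto_unique[of "at_left q" ?g] by auto
  then show ?thesis using f t by (cases "t = p"; cases "t = q") auto
qed

text \<open>The chords are inserted one interval at a time; the value at the breakpoint
\<open>\<tau> m\<close> is shared by consecutive chords, which is where continuity comes from.\<close>

lemma mclp_feasible_piecewise_chords:
  fixes A :: "real ^ 'j ^ 'k" and \<tau> :: "nat \<Rightarrow> real"
  assumes W: "mclp_feasible T A \<beta> b W"
    and \<tau>: "\<tau> 0 = 0" "\<tau> n = T" "\<And>i. i < n \<Longrightarrow> \<tau> i < \<tau> (Suc i)"
    and aff: "\<And>i. i < n \<Longrightarrow> \<exists>w v. \<forall>t\<in>{\<tau> i..\<tau> (Suc i)}. c \<bullet> W t = w + t *\<^sub>R v"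
    and "m \<le> n"
  shows "\<exists>V. mclp_feasible T A \<beta> b V \<and> (\<forall>t. c \<bullet> V t = c \<bullet> W t) \<and> V T = W T \<and>
    continuous_on {0..\<tau> m} V \<and> (\<forall>i<m. \<exists>w v. \<forall>t\<in>{\<tau> i..\<tau> (Suc i)}. V t = w + t *\<^sub>R v)"
  using \<open>m \<le> n\<close>
proof (induction m)
  case 0
  show ?case using W \<tau>(1) by (intro exI[of _ W]) auto
next
  case (Suc m)
  then obtain V where V: "mclp_feasible T A \<beta> b V" "\<And>t. c \<bullet> V t = c \<bullet> W t" "V T = W T"
    "continuous_on {0..\<tau> m} V" "\<And>i. i < m \<Longrightarrow> \<exists>w v. \<forall>t\<in>{\<tau> i..\<tau> (Suc i)}. V t = w + t *\<^sub>R v"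
    by auto
  let ?s = "\<tau> m" and ?r = "\<tau> (Suc m)"
  let ?V = "chord_replace ?s ?r V"
  have le: "\<tau> i \<le> \<tau> j" if "i \<le> j" "j \<le> n" for i j
    using breakpoints_mono[where \<tau> = \<tau> and n = n, OF \<tau>(3) that] .
  have sr: "0 \<le> ?s" "?s < ?r" "?r \<le> T"
    using le[of 0 m] le[of "Suc m" n] \<tau> Suc.prems by auto
  have before: "?V t = V t" if "t \<le> ?s" for t using sr that by simp
  have piece: "?V t = (V ?s - (?s / (?r - ?s)) *\<^sub>R (V ?r - V ?s)) + t *\<^sub>R ((1 / (?r - ?s)) *\<^sub>R (V ?r - V ?s))"
    if "t \<in> {?s..?r}" for t
    using that unfolding chord_replace_def chord_eq by simp
  have "mclp_feasible T A \<beta> b ?V" by (rule mclp_feasible_chord_replace[OF V(1) sr])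
  moreover have "c \<bullet> ?V t = c \<bullet> W t" for t
  proof -
    obtain w v where "\<forall>t\<in>{?s..?r}. c \<bullet> W t = w + t *\<^sub>R v" using aff[of m] Suc.prems by auto
    then have "chord ?s ?r (\<lambda>t. c \<bullet> W t) t = c \<bullet> W t" if "t \<in> {?s..?r}"
      using sr that by (intro chord_affine) auto
    moreover have "c \<bullet> ?V t = chord_replace ?s ?r (\<lambda>t. c \<bullet> V t) t"
      by (intro linear_chord_replace bounded_linear.linear bounded_linear_inner_right)
    ultimately show ?thesis by (simp add: V(2) chord_replace_def)
  qed
  moreover have "?V T = W T" using sr V(3) by simp
  moreover have "continuous_on {0..?r} ?V"
  proof -
    have "continuous_on {0..?s} ?V"
      using V(4) before by (subst continuous_on_cong[OF refl, where g = V]) auto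
    moreover have "continuous_on {?s..?r} ?V"
      using continuous_on_chord[of "{?s..?r}" ?s ?r V]
      by (subst continuous_on_cong[OF refl, where g = "chord ?s ?r V"]) (auto simp: chord_replace_def)
    ultimately have "continuous_on ({0..?s} \<union> {?s..?r}) ?V"
      by (intro continuous_on_closed_Un) auto
    moreover have "{0..?s} \<union> {?s..?r} = {0..?r}" using sr by auto
    ultimately show ?thesis by simp
  qed
  moreover have "\<exists>w v. \<forall>t\<in>{\<tau> i..\<tau> (Suc i)}. ?V t = w + t *\<^sub>R v" if "i < Suc m" for i
  proof (cases "i = m")
    case True
    then show ?thesis using piece by blast
  next
    case False
    then have "i < m" using that by simp
    then have "\<tau> (Suc i) \<le> ?s" using le[of "Suc i" m] Suc.prems by simp
    then have "?V t = V t" if "t \<in> {\<tau> i..\<tau> (Suc i)}" for t using before[of t] that by simp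
    then show ?thesis using V(5)[OF \<open>i < m\<close>] by simp
  qed
  ultimately show ?case by blast
qed

text \<open>An optimal \<open>U\<close> may jump at \<open>T\<close>, where the weight \<open>\<gamma>\<close> rather than \<open>c\<close> decides.
The value at \<open>T\<close> is therefore first lowered to the left limit, so that the last chord ends there,
and restored afterwards.\<close>

theorem mclp_piecewise_linear_optimum:
  fixes A :: "real ^ 'j ^ 'k"
  assumes T: "0 < T" and U: "mclp_optimal T A \<beta> b \<gamma> c U"
    and pl: "piecewise_linear_on 0 T (\<lambda>t. c \<bullet> U t)"
  shows "\<exists>V. mclp_optimal T A \<beta> b \<gamma> c V \<and> continuous_on {0<..<T} V \<and> piecewise_linear_on 0 T V"
proof -
  have fU: "mclp_feasible T A \<beta> b U" using U by (simp add: mclp_optimal_def)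
  then have aU: "admissible T U" by (simp add: mclp_feasible_def)
  obtain n \<tau> where \<tau>: "\<tau> 0 = 0" "\<tau> n = T" "\<And>i. i < n \<Longrightarrow> \<tau> i < \<tau> (Suc i)"
    and aff: "\<And>i. i < n \<Longrightarrow> \<exists>v w. \<forall>t\<in>{\<tau> i<..<\<tau> (Suc i)}. c \<bullet> U t = w + t *\<^sub>R v"
    using pl unfolding piecewise_linear_on_def by metis
  obtain L where L: "(U \<longlongrightarrow> L) (at_left T)" "\<And>t. t \<in> {0..<T} \<Longrightarrow> U t \<le> L" "L \<le> U T"
    using admissible_left_limit[OF aU, of T] T by auto
  have final_value: "admissible T (V(T := y))" if "admissible T V" "\<And>t. t \<in> {0..<T} \<Longrightarrow> V t \<le> y" for V y
    unfolding admissible_def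
  proof (intro conjI ballI)
    have "0 \<le> V 0" "V 0 \<le> y" using that T by (auto simp: admissible_def)
    then have "0 \<le> y" by (rule order_trans)
    then show "0 \<le> (V(T := y)) t" if "t \<in> {0..T}" for t
      using \<open>admissible T V\<close> that by (auto simp: admissible_def)
    show "mono_on {0..T} (V(T := y))"
      using that by (auto simp: admissible_def mono_on_def)
    show "continuous (at_right t) (V(T := y))" if t: "t \<in> {0..<T}" for t
    proof -
      have "\<forall>\<^sub>F x in at_right t. V x = (V(T := y)) x"
        using t by (auto simp: eventually_at_right[of t T] intro!: exI[of _ T])
      then show ?thesis
        using admissible_right_tendsto[OF \<open>admissible T V\<close>, of t] t
        by (auto simp: continuous_within intro: Lim_transform_eventually)
    qed
  qed
  \<comment> \<open>\<open>?W\<close> is left-continuous at \<open>T\<close>, so the last piece of \<open>c \<bullet> ?W\<close> is affine up to \<open>T\<close>.\<close>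
  let ?W = "U(T := L)"
  have "A *v L \<le> \<beta> + T *\<^sub>R b"
    unfolding less_eq_vec_def
  proof
    fix k
    have "((\<lambda>t. (A *v U t) $ k) \<longlongrightarrow> (A *v L) $ k) (at_left T)"
      by (intro tendsto_vec_nth bounded_linear.tendsto[OF matrix_vector_mul_bounded_linear] L)
    moreover have "((\<lambda>t. (\<beta> + t *\<^sub>R b) $ k) \<longlongrightarrow> (\<beta> + T *\<^sub>R b) $ k) (at_left T)"
      by (intro tendsto_intros)
    moreover have "\<forall>\<^sub>F t in at_left T. (A *v U t) $ k \<le> (\<beta> + t *\<^sub>R b) $ k"
      using fU T by (auto simp: eventually_at_left[OF T] mclp_feasible_def less_eq_vec_def intro!: exI[of _ 0])
    ultimately show "(A *v L) $ k \<le> (\<beta> + T *\<^sub>R b) $ k"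
      by (intro tendsto_le[of "at_left T"]) auto
  qed
  then have fW: "mclp_feasible T A \<beta> b ?W"
    using fU final_value[OF aU L(2)] by (auto simp: mclp_feasible_def)
  have closed: "\<exists>w v. \<forall>t\<in>{\<tau> i..\<tau> (Suc i)}. c \<bullet> ?W t = w + t *\<^sub>R v" if i: "i < n" for i
  proof -
    obtain w v where wv: "\<forall>t\<in>{\<tau> i<..<\<tau> (Suc i)}. c \<bullet> U t = w + t *\<^sub>R v" using aff[OF i] by blast
    have b: "0 \<le> \<tau> i" "\<tau> i < \<tau> (Suc i)" "\<tau> (Suc i) \<le> T"
      using breakpoints_mono[where \<tau> = \<tau> and n = n, OF \<tau>(3), of 0 i] breakpoints_mono[where \<tau> = \<tau> and n = n, OF \<tau>(3), of "Suc i" n] \<tau> i by auto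
    have "c \<bullet> ?W t = w + t *\<^sub>R v" if "t \<in> {\<tau> i..\<tau> (Suc i)}" for t
    proof (rule affine_closed_interval[OF b(2) _ _ _ that])
      show "c \<bullet> ?W t = w + t *\<^sub>R v" if "t \<in> {\<tau> i<..<\<tau> (Suc i)}" for t
        using wv that b by auto
      show "((\<lambda>t. c \<bullet> ?W t) \<longlongrightarrow> c \<bullet> ?W (\<tau> i)) (at_right (\<tau> i))"
      proof (rule tendsto_inner[OF tendsto_const])
        show "(?W \<longlongrightarrow> ?W (\<tau> i)) (at_right (\<tau> i))"
          by (rule admissible_right_tendsto[of T]) (use fW b in \<open>auto simp: mclp_feasible_def\<close>)
      qed
      have "\<forall>\<^sub>F x in at_left (\<tau> (Suc i)). c \<bullet> U x = c \<bullet> ?W x"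
        using b by (auto simp: eventually_at_left[OF b(2)] intro!: exI[of _ "\<tau> i"])
      moreover have "((\<lambda>t. c \<bullet> U t) \<longlongrightarrow> c \<bullet> ?W (\<tau> (Suc i))) (at_left (\<tau> (Suc i)))"
      proof (cases "\<tau> (Suc i) = T")
        case True
        then show ?thesis using L by (auto intro!: tendsto_inner)
      next
        case False
        then have "isCont (\<lambda>t. c \<bullet> U t) (\<tau> (Suc i))"
          using mclp_optimal_rate_concave(1)[OF T U] b
          by (auto simp: continuous_on_eq_continuous_at)
        then show ?thesis
          using False by (auto simp: isCont_def filterlim_at_split)
      qed
      ultimately show "((\<lambda>t. c \<bullet> ?W t) \<longlongrightarrow> c \<bullet> ?W (\<tau> (Suc i))) (at_left (\<tau> (Suc i)))"
        by (rule Lim_transform_eventually[rotated])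
    qed
    then show ?thesis by blast
  qed
  obtain V where V: "mclp_feasible T A \<beta> b V" "\<And>t. c \<bullet> V t = c \<bullet> ?W t" "V T = L" "continuous_on {0..T} V"
    "\<And>i. i < n \<Longrightarrow> \<exists>w v. \<forall>t\<in>{\<tau> i..\<tau> (Suc i)}. V t = w + t *\<^sub>R v"
    using mclp_feasible_piecewise_chords[OF fW \<tau> closed order_refl] \<tau>(2) by auto
  have aV: "admissible T V" using V(1) by (simp add: mclp_feasible_def)
  let ?V = "V(T := U T)"
  have "V t \<le> U T" if "t \<in> {0..<T}" for t
  proof -
    have "V t \<le> V T" using aV that by (auto simp: admissible_def mono_on_def)
    then show ?thesis using V(3) L(3) by simp
  qed
  then have "mclp_feasible T A \<beta> b ?V"
    using V(1) fU T final_value[OF aV, of "U T"] by (auto simp: mclp_feasible_def)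
  moreover have "mclp_value T \<gamma> c ?V = mclp_value T \<gamma> c U"
  proof -
    have "integral {0..T} (\<lambda>t. c \<bullet> ?V t) = integral {0..T} (\<lambda>t. c \<bullet> U t)"
      using V(2) by (intro integral_cong) auto
    moreover have "admissible T ?V" using \<open>mclp_feasible T A \<beta> b ?V\<close> by (simp add: mclp_feasible_def)
    ultimately show ?thesis
      using mclp_value_eq[OF _ T, of ?V] mclp_value_eq[OF aU T] by (simp only: fun_upd_same)
  qed
  ultimately have "mclp_optimal T A \<beta> b \<gamma> c ?V"
    using U by (simp add: mclp_optimal_def)
  moreover have "continuous_on {0<..<T} ?V"
  proof (subst continuous_on_cong[OF refl])
    show "continuous_on {0<..<T} V" by (rule continuous_on_subset[OF V(4)]) auto
  qed auto
  moreover have "piecewise_linear_on 0 T ?V"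
    unfolding piecewise_linear_on_def
  proof (intro exI[of _ n] exI[of _ \<tau>] conjI allI impI \<tau>)
    fix i assume i: "i < n"
    obtain w v where wv: "\<forall>t\<in>{\<tau> i..\<tau> (Suc i)}. V t = w + t *\<^sub>R v" using V(5)[OF i] by blast
    moreover have "\<tau> (Suc i) \<le> T"
      using breakpoints_mono[where \<tau> = \<tau> and n = n, OF \<tau>(3), of "Suc i" n] \<tau>(2) i by auto
    ultimately have "\<forall>t\<in>{\<tau> i<..<\<tau> (Suc i)}. ?V t = w + t *\<^sub>R v" by auto
    then show "\<exists>v w. \<forall>t\<in>{\<tau> i<..<\<tau> (Suc i)}. ?V t = w + t *\<^sub>R v" by blast
  qed
  ultimately show ?thesis by blast
qed

section \<open>The dual as a primal problem\<close>

lemma mclp_dual_feasible_iff: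
  fixes A :: "real ^ 'j ^ 'k"
  shows "mclp_dual_feasible T A \<gamma> c P \<longleftrightarrow> mclp_feasible T (- transpose A) (- \<gamma>) (- c) P"
proof -
  have "(- transpose A) *v x = - (transpose A *v x)" for x :: "real ^ 'k"
    by (simp add: vec_eq_iff matrix_vector_mult_def sum_negf)
  moreover have "- y \<le> - \<gamma> + t *\<^sub>R - c \<longleftrightarrow> \<gamma> + t *\<^sub>R c \<le> y" for y t
    by (simp add: less_eq_vec_def algebra_simps)
  ultimately show ?thesis
    by (simp add: mclp_dual_feasible_def mclp_feasible_def)
qed

lemma mclp_dual_value_eq: "mclp_dual_value T \<beta> b P = - mclp_value T (- \<beta>) (- b) P"
proof -
  have "(LINT t:S|M. (- \<beta> + (T - t) *\<^sub>R - b) $ i) = - (LINT t:S|M. (\<beta> + (T - t) *\<^sub>R b) $ i)"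
    for S i and M :: "real measure"
  proof -
    have "(\<lambda>t. indicator S t *\<^sub>R (- \<beta> + (T - t) *\<^sub>R - b) $ i) = (\<lambda>t. - (indicator S t *\<^sub>R (\<beta> + (T - t) *\<^sub>R b) $ i))"
      by (auto simp: fun_eq_iff algebra_simps)
    then show ?thesis
      unfolding set_lebesgue_integral_def by (simp only: Bochner_Integration.integral_minus)
  qed
  then show ?thesis
    by (simp only: mclp_dual_value_def mclp_value_def stieltjes_integral_def sum_negf minus_minus)
qed

text \<open>Lets every result on M-CLP be applied to the dual problem.\<close>

lemma mclp_dual_optimal_iff:
  "mclp_dual_optimal T A \<beta> b \<gamma> c P \<longleftrightarrow> mclp_optimal T (- transpose A) (- \<gamma>) (- c) (- \<beta>) (- b) P"
  by (simp add: mclp_dual_optimal_def mclp_optimal_def mclp_dual_feasible_iff mclp_dual_value_eq)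

lemma slack_dual:
  fixes A :: "real ^ 'j ^ 'k"
  shows "primal_slack (- transpose A) (- \<gamma>) (- c) P t = dual_slack A \<gamma> c P t"
    and "dual_slack (- transpose A) (- \<beta>) (- b) U t = primal_slack A \<beta> b U t"
  by (auto simp: primal_slack_def dual_slack_def vec_eq_iff matrix_vector_mult_def transpose_def sum_negf)

lemma complementary_dual:
  "complementary T A \<beta> b \<gamma> c U P \<Longrightarrow> complementary T (- transpose A) (- \<gamma>) (- c) (- \<beta>) (- b) P U"
  by (simp add: complementary_def slack_dual)

section \<open>Rigidity in general position\<close>

text \<open>Otherwise a basis chosen among the columns in \<open>S\<close> would represent \<open>c\<close> with fewer than
\<open>CARD('m)\<close> columns.\<close>

lemma spanning_columns_of_general_position:
  fixes c :: "real ^ 'm" and M :: "real ^ 'n ^ 'm"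
  assumes gp: "general_position c M" and c: "c \<in> span ((\<lambda>l. column l M) ` S)"
  shows "span ((\<lambda>l. column l M) ` S) = UNIV"
proof -
  let ?C = "(\<lambda>l. column l M) ` S"
  obtain B where B: "B \<subseteq> ?C" "independent B" "?C \<subseteq> span B" "card B = dim ?C"
    using basis_exists[of ?C] by blast
  obtain S' where S': "S' \<subseteq> S" "inj_on (\<lambda>l. column l M) S'" "B = (\<lambda>l. column l M) ` S'"
    using B(1) by (meson subset_image_inj)
  have "span ?C \<subseteq> span B" using B(3) by (simp add: span_minimal)
  then have "\<not> card S' < CARD('m)"
    using gp c S'(3) unfolding general_position_def by blast
  then have "CARD('m) \<le> dim ?C" using card_image[OF S'(2)] S'(3) B(4) by simp
  moreover have "dim ?C \<le> CARD('m)" using dim_subset_UNIV[of ?C] by simp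
  ultimately show ?thesis using dim_eq_full[of ?C] by simp
qed

text \<open>The hypotheses say that \<open>\<delta>\<close> is orthogonal to every column of \<open>[transpose A, I]\<close> that occurs in
the representation \<open>c = transpose A *v v - g\<close>, and these columns span.\<close>

lemma general_position_kernel:
  fixes A :: "real ^ 'j ^ 'k" and c \<delta> g :: "real ^ 'j" and v :: "real ^ 'k"
  assumes gp: "general_position c (append_identity (transpose A))"
    and c: "c = transpose A *v v - g"
    and tight: "\<And>k. v $ k \<noteq> 0 \<Longrightarrow> (A *v \<delta>) $ k = 0"
    and fixed: "\<And>j. g $ j \<noteq> 0 \<Longrightarrow> \<delta> $ j = 0"
  shows "\<delta> = 0"
proof -
  let ?M = "append_identity (transpose A)"
  define S where "S = Inl ` {k. v $ k \<noteq> 0} \<union> Inr ` {j. g $ j \<noteq> 0}"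
  let ?C = "(\<lambda>l. column l ?M) ` S"
  have col: "column (Inl k) ?M = row k A" "column (Inr j) ?M = axis j 1" for k j
    by (auto simp: column_def row_def append_identity_def transpose_def mat_def axis_def vec_eq_iff)
  have "transpose A *v v = (\<Sum>k\<in>UNIV. v $ k *\<^sub>R row k A)"
    by (simp add: vec_eq_iff matrix_vector_mult_def transpose_def row_def mult.commute)
  moreover have "v $ k *\<^sub>R row k A \<in> span ?C" for k
  proof (cases "v $ k = 0")
    case False
    then have "row k A \<in> ?C" unfolding col(1)[symmetric] by (intro imageI) (simp add: S_def)
    then show ?thesis by (intro span_scale span_base)
  qed (simp add: span_zero)
  ultimately have "transpose A *v v \<in> span ?C" by (simp add: span_sum)
  moreover have "g \<in> span ?C"
  proof -
    have "g $ j *\<^sub>R axis j 1 \<in> span ?C" for j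
    proof (cases "g $ j = 0")
      case False
      then have "axis j 1 \<in> ?C" unfolding col(2)[symmetric] by (intro imageI) (simp add: S_def)
      then show ?thesis by (intro span_scale span_base)
    qed (simp add: span_zero)
    then have "(\<Sum>j\<in>UNIV. g $ j *\<^sub>R axis j 1) \<in> span ?C" by (intro span_sum)
    then show ?thesis using basis_expansion[of g] by (simp only: scalar_mult_eq_scaleR)
  qed
  ultimately have "c \<in> span ?C" unfolding c by (rule span_diff)
  then have "span ?C = UNIV" by (rule spanning_columns_of_general_position[OF gp])
  moreover have "orthogonal \<delta> x" if "x \<in> ?C" for x
  proof -
    have "\<delta> \<bullet> row k A = (A *v \<delta>) $ k" for k
      by (simp add: matrix_vector_mult_def row_def inner_vec_def mult.commute)
    then show ?thesis
      using that tight fixed by (auto simp: S_def col orthogonal_def inner_axis)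
  qed
  then have "orthogonal \<delta> x" if "x \<in> span ?C" for x
    using orthogonal_to_span that by blast
  ultimately have "orthogonal \<delta> \<delta>" by simp
  then show ?thesis by (simp add: orthogonal_self)
qed

text \<open>Along a piece on which \<open>P\<close> is affine, a strictly increasing component of \<open>P\<close> forces
zeros of the primal slack that are dense, hence everywhere. A dual slack that is affine,
nonnegative and nonconstant on an open interval is positive there, which freezes the corresponding
component of \<open>U\<close>.\<close>

lemma affine_dual_piece:
  fixes A :: "real ^ 'j ^ 'k"
  assumes compl: "complementary T A \<beta> b \<gamma> c U P"
    and U: "admissible T U" and P: "mclp_dual_feasible T A \<gamma> c P"
    and pq: "0 \<le> p" "p < q" "q \<le> T"
    and affine: "\<forall>t\<in>{p<..<q}. P (T - t) = w - t *\<^sub>R v"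
    and g: "g = transpose A *v v - c"
  shows "\<And>t k. t \<in> {p<..<q} \<Longrightarrow> v $ k \<noteq> 0 \<Longrightarrow> primal_slack A \<beta> b U t $ k = 0"
    and "\<And>t j. t \<in> {p<..<q} \<Longrightarrow> g $ j \<noteq> 0 \<Longrightarrow> 0 < dual_slack A \<gamma> c P (T - t) $ j"
    and "\<And>s t j. s \<in> {p<..<q} \<Longrightarrow> t \<in> {p<..<q} \<Longrightarrow> g $ j \<noteq> 0 \<Longrightarrow> U s $ j = U t $ j"
    and "\<And>k. 0 \<le> v $ k"
proof -
  note piece = bspec[OF affine]
  have aP: "admissible T P" using P by (simp add: mclp_dual_feasible_def)
  have Pm: "P s \<le> P t" if "0 \<le> s" "s \<le> t" "t \<le> T" for s t
    using aP that by (auto simp: admissible_def mono_on_def)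
  have Um: "U s \<le> U t" if "0 \<le> s" "s \<le> t" "t \<le> T" for s t
    using U that by (auto simp: admissible_def mono_on_def)
  have diff: "P (T - s) $ k - P (T - t) $ k = (t - s) * v $ k" if "s \<in> {p<..<q}" "t \<in> {p<..<q}" for s t k
    using that by (simp add: piece algebra_simps)
  obtain m where m: "p < m" "m < q" using dense[OF pq(2)] by blast
  obtain m' where m': "m < m'" "m' < q" using dense[OF m(2)] by blast
  show v: "0 \<le> v $ k" for k
  proof -
    have "P (T - m') $ k \<le> P (T - m) $ k"
      using Pm[of "T - m'" "T - m"] m m' pq by (auto simp: less_eq_vec_def)
    then have "0 \<le> (m' - m) * v $ k" using diff[of m m' k] m m' by auto
    then show ?thesis using m' by (simp add: zero_le_mult_iff)
  qed
  show "primal_slack A \<beta> b U t $ k = 0" if t: "t \<in> {p<..<q}" and k: "v $ k \<noteq> 0" for t k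
  proof (rule ccontr)
    assume "primal_slack A \<beta> b U t $ k \<noteq> 0"
    then have "\<forall>\<^sub>F y in at_right t. primal_slack A \<beta> b U y $ k \<noteq> 0"
      using primal_slack_right_tendsto[OF U, of t A \<beta> b k] t pq by (auto intro: tendsto_imp_eventually_ne)
    then obtain y0 where y0: "t < y0" "\<And>y. t < y \<Longrightarrow> y < y0 \<Longrightarrow> primal_slack A \<beta> b U y $ k \<noteq> 0"
      by (auto simp: eventually_at_right[of t "t + 1"])
    obtain r where r: "t < r" "r < min y0 q" using dense[of t "min y0 q"] y0(1) t by auto
    obtain s where s: "t < s" "s < r" using dense[OF r(1)] by blast
    have "0 < (r - s) * v $ k" using v[of k] k s by (simp add: order.strict_iff_order)
    then have "P (T - r) $ k < P (T - s) $ k" using diff[of s r k] s r t by auto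
    then obtain z where "z \<in> {T - r<..T - s}" "primal_slack A \<beta> b U (T - z) $ k = 0"
      using complementaryD(2)[OF compl, of "T - r" "T - s" k] s r t pq by auto
    then show False using y0(2)[of "T - z"] s r by auto
  qed
  show pos: "0 < dual_slack A \<gamma> c P (T - t) $ j" if t: "t \<in> {p<..<q}" and j: "g $ j \<noteq> 0" for t j
  proof -
    define h where "h t = dual_slack A \<gamma> c P (T - t) $ j" for t
    have nonneg: "0 \<le> h t" if "t \<in> {p<..<q}" for t
      using P that pq unfolding h_def
      by (auto simp: dual_slack_def mclp_dual_feasible_def less_eq_vec_def)
    have slope: "h s - h t = (t - s) * g $ j" if "s \<in> {p<..<q}" "t \<in> {p<..<q}" for s t
      using that unfolding h_def dual_slack_def g
      by (simp add: piece matrix_vector_mult_diff_distrib matrix_vector_mult_scaleR algebra_simps)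
    have "h t \<noteq> 0"
    proof
      assume z: "h t = 0"
      obtain y where y: "p < y" "y < t" using dense[of p t] t by auto
      obtain y' where y': "t < y'" "y' < q" using dense[of t q] t by auto
      have "0 \<le> (t - y) * g $ j" "0 \<le> (t - y') * g $ j"
        using slope[of y t] slope[of y' t] nonneg[of y] nonneg[of y'] y y' t z by auto
      then show False using y y' j by (auto simp: zero_le_mult_iff)
    qed
    then show ?thesis using nonneg[OF t] by (simp add: h_def)
  qed
  have "U s $ j = U t $ j" if st: "s \<in> {p<..<q}" "t \<in> {p<..<q}" "g $ j \<noteq> 0" "s < t" for s t j
  proof (rule ccontr)
    assume "U s $ j \<noteq> U t $ j"
    then have "U s $ j < U t $ j"
      using Um[of s t] st pq by (auto simp: less_eq_vec_def order.strict_iff_order)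
    then obtain z where "z \<in> {s<..t}" "dual_slack A \<gamma> c P (T - z) $ j = 0"
      using complementaryD(1)[OF compl, of s t j] st pq by auto
    then show False using pos[of z j] st by auto
  qed
  then show "U s $ j = U t $ j" if "s \<in> {p<..<q}" "t \<in> {p<..<q}" "g $ j \<noteq> 0" for s t j
    using that by (metis linorder_cases)
qed

text \<open>The rate \<open>u\<close> is chosen before \<open>U\<close>: it depends on \<open>P\<close> and the piece only, which
yields uniqueness as well as linearity.\<close>

lemma rigid_rate:
  fixes A :: "real ^ 'j ^ 'k"
  assumes gp: "general_position c (append_identity (transpose A))"
    and P: "mclp_dual_feasible T A \<gamma> c P"
    and pq: "0 \<le> p" "p < q" "q \<le> T"
    and affine: "\<forall>t\<in>{p<..<q}. P (T - t) = w - t *\<^sub>R v"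
  shows "\<exists>u. \<forall>U. admissible T U \<longrightarrow> complementary T A \<beta> b \<gamma> c U P \<longrightarrow>
    (\<forall>s\<in>{p<..<q}. \<forall>t\<in>{p<..<q}. U t - U s = (t - s) *\<^sub>R u)"
proof (cases "\<exists>U. admissible T U \<and> complementary T A \<beta> b \<gamma> c U P")
  case True
  then obtain U0 where U0: "admissible T U0" "complementary T A \<beta> b \<gamma> c U0 P" by blast
  obtain t0 where t0: "p < t0" "t0 < q" using dense[OF pq(2)] by blast
  obtain s0 where s0: "p < s0" "s0 < t0" using dense[OF t0(1)] by blast
  define u where "u = (1 / (t0 - s0)) *\<^sub>R (U0 t0 - U0 s0)"
  define g where "g = transpose A *v v - c"
  have tight: "(A *v (U t - U s)) $ k = (t - s) * b $ k"
    if "admissible T U" "complementary T A \<beta> b \<gamma> c U P" "s \<in> {p<..<q}" "t \<in> {p<..<q}" "v $ k \<noteq> 0" for U s t k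
    using affine_dual_piece(1)[OF that(2,1) P pq affine g_def that(3,5)]
      affine_dual_piece(1)[OF that(2,1) P pq affine g_def that(4,5)]
    by (simp add: primal_slack_def matrix_vector_mult_diff_distrib algebra_simps)
  have fixed: "(U t - U s) $ j = 0"
    if "admissible T U" "complementary T A \<beta> b \<gamma> c U P" "s \<in> {p<..<q}" "t \<in> {p<..<q}" "g $ j \<noteq> 0" for U s t j
    using affine_dual_piece(3)[OF that(2,1) P pq affine g_def that(3,4,5)] by simp
  have "U t - U s = (t - s) *\<^sub>R u"
    if U: "admissible T U" "complementary T A \<beta> b \<gamma> c U P" and st: "s \<in> {p<..<q}" "t \<in> {p<..<q}" for U s t
  proof -
    have "(U t - U s) - (t - s) *\<^sub>R u = 0"
    proof (rule general_position_kernel[OF gp])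
      show "c = transpose A *v v - g" by (simp add: g_def)
      show "(A *v ((U t - U s) - (t - s) *\<^sub>R u)) $ k = 0" if "v $ k \<noteq> 0" for k
        using tight[OF U st that] tight[OF U0, of s0 t0 k] s0 t0 that
        by (simp add: u_def matrix_vector_mult_diff_distrib[of A "U t - U s"] matrix_vector_mult_scaleR)
      show "((U t - U s) - (t - s) *\<^sub>R u) $ j = 0" if "g $ j \<noteq> 0" for j
        using fixed[OF U st that] fixed[OF U0, of s0 t0 j] s0 t0 that by (simp add: u_def)
    qed
    then show ?thesis by simp
  qed
  then show ?thesis by blast
qed blast

text \<open>Let \<open>\<delta>\<close> be the jump at \<open>q\<close>. The primal slacks that vanish before \<open>q\<close> remain nonnegative at \<open>q\<close>, so
\<open>A *v \<delta> \<le> 0\<close> on the support of \<open>v\<close>. If \<open>\<delta> $ j > 0\<close> and \<open>g $ j \<noteq> 0\<close>, the dual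
slack at \<open>T - q\<close> is zero but positive on the piece, so \<open>g $ j > 0\<close>. Thus
\<open>0 = c \<bullet> \<delta> = v \<bullet> (A *v \<delta>) - g \<bullet> \<delta>\<close> is a sum of nonpositive terms; all of them vanish, and general position gives \<open>\<delta> = 0\<close>.\<close>

lemma rigid_left_continuous:
  fixes A :: "real ^ 'j ^ 'k"
  assumes gp: "general_position c (append_identity (transpose A))"
    and U: "mclp_feasible T A \<beta> b U" and P: "mclp_dual_feasible T A \<gamma> c P"
    and compl: "complementary T A \<beta> b \<gamma> c U P"
    and pq: "0 \<le> p" "p < q" "q < T"
    and affine: "\<forall>t\<in>{p<..<q}. P (T - t) = w - t *\<^sub>R v"
    and Pcont: "isCont P (T - q)"
    and rate: "isCont (\<lambda>t. c \<bullet> U t) q"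
  shows "(U \<longlongrightarrow> U q) (at_left q)"
proof -
  have aU: "admissible T U" using U by (simp add: mclp_feasible_def)
  have qT: "q \<le> T" using pq by simp
  define g where "g = transpose A *v v - c"
  note rigid = affine_dual_piece[OF compl aU P pq(1,2) qT affine g_def]
  obtain l where l: "(U \<longlongrightarrow> l) (at_left q)" "\<And>t. t \<in> {0..<q} \<Longrightarrow> U t \<le> l" "l \<le> U q"
    using admissible_left_limit[OF aU, of q] pq by auto
  define \<delta> where "\<delta> = U q - l"
  have \<delta>: "0 \<le> \<delta> $ j" for j using l(3) by (simp add: \<delta>_def less_eq_vec_def)
  have near: "\<forall>\<^sub>F t in at_left q. t \<in> {p<..<q}"
    using pq by (auto simp: eventually_at_left[OF pq(2)])
  have Aneg: "(A *v \<delta>) $ k \<le> 0" if k: "v $ k \<noteq> 0" for k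
  proof -
    have "((\<lambda>t. primal_slack A \<beta> b U t $ k) \<longlongrightarrow> (\<beta> + q *\<^sub>R b - A *v l) $ k) (at_left q)"
      unfolding primal_slack_def
      by (intro tendsto_vec_nth tendsto_intros l bounded_linear.tendsto[OF matrix_vector_mul_bounded_linear])
    moreover have "((\<lambda>t. primal_slack A \<beta> b U t $ k) \<longlongrightarrow> 0) (at_left q)"
      using near rigid(1)[OF _ k] by (intro tendsto_eventually) (auto elim: eventually_mono)
    ultimately have "(\<beta> + q *\<^sub>R b - A *v l) $ k = 0"
      by (intro tendsto_unique[of "at_left q"]) auto
    moreover have "(A *v U q) $ k \<le> (\<beta> + q *\<^sub>R b) $ k"
      using U pq by (auto simp: mclp_feasible_def less_eq_vec_def)
    ultimately show ?thesis by (simp add: \<delta>_def matrix_vector_mult_diff_distrib)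
  qed
  have "((\<lambda>t. P (T - t)) \<longlongrightarrow> P (T - q)) (at_left q)"
    using Pcont by (intro isCont_tendsto_compose[of _ P] tendsto_intros)
  moreover have "((\<lambda>t. P (T - t)) \<longlongrightarrow> w - q *\<^sub>R v) (at_left q)"
  proof (rule Lim_transform_eventually)
    show "((\<lambda>t. w - t *\<^sub>R v) \<longlongrightarrow> w - q *\<^sub>R v) (at_left q)" by (intro tendsto_intros)
    show "\<forall>\<^sub>F t in at_left q. w - t *\<^sub>R v = P (T - t)"
      using near by (rule eventually_mono) (simp add: affine)
  qed
  ultimately have Pq: "P (T - q) = w - q *\<^sub>R v"
    by (intro tendsto_unique[of "at_left q"]) auto
  obtain s where s: "p < s" "s < q" using dense[OF pq(2)] by blast
  have gpos: "0 < g $ j" if g: "g $ j \<noteq> 0" and jump: "0 < \<delta> $ j" for j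
  proof -
    have "U s $ j < U q $ j"
      using l(2)[of s] jump s pq by (auto simp: \<delta>_def less_eq_vec_def intro: le_less_trans)
    then obtain z where z: "z \<in> {s<..q}" "dual_slack A \<gamma> c P (T - z) $ j = 0"
      using complementaryD(1)[OF compl, of s q j] s pq by auto
    then have "z = q" using rigid(2)[of z j] g s by force
    with z have "dual_slack A \<gamma> c P (T - q) $ j = 0" by simp
    moreover have "dual_slack A \<gamma> c P (T - s) $ j - dual_slack A \<gamma> c P (T - q) $ j = (q - s) * g $ j"
    proof -
      have Ps: "P (T - s) = w - s *\<^sub>R v" using affine s by simp
      show ?thesis
        unfolding dual_slack_def g_def Ps Pq
        by (simp add: matrix_vector_mult_diff_distrib matrix_vector_mult_scaleR algebra_simps)
    qed
    ultimately have "0 < (q - s) * g $ j" using rigid(2)[of s j] g s by auto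
    then show ?thesis using s by (simp add: zero_less_mult_iff)
  qed
  have "((\<lambda>t. c \<bullet> U t) \<longlongrightarrow> c \<bullet> U q) (at_left q)"
    using rate by (simp add: isCont_def filterlim_at_split)
  moreover have "((\<lambda>t. c \<bullet> U t) \<longlongrightarrow> c \<bullet> l) (at_left q)" by (intro tendsto_intros l)
  ultimately have "c \<bullet> U q = c \<bullet> l" by (intro tendsto_unique[of "at_left q"]) auto
  then have "c \<bullet> \<delta> = 0" by (simp add: \<delta>_def inner_diff_right)
  moreover have "c \<bullet> \<delta> = v \<bullet> (A *v \<delta>) - g \<bullet> \<delta>"
    by (simp add: g_def inner_diff_left dot_lmul_matrix)
  moreover have vA: "v $ k * (A *v \<delta>) $ k \<le> 0" for k
    using rigid(4)[of k] Aneg[of k] by (cases "v $ k = 0") (auto simp: mult_le_0_iff)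
  moreover have g\<delta>: "0 \<le> g $ j * \<delta> $ j" for j
    using \<delta>[of j] gpos[of j] by (cases "g $ j = 0 \<or> \<delta> $ j = 0") (auto simp: order.strict_iff_order)
  ultimately have sums: "(\<Sum>k\<in>UNIV. - (v $ k * (A *v \<delta>) $ k)) = 0" "(\<Sum>j\<in>UNIV. g $ j * \<delta> $ j) = 0"
    using sum_nonneg[of UNIV "\<lambda>k. - (v $ k * (A *v \<delta>) $ k)"] sum_nonneg[of UNIV "\<lambda>j. g $ j * \<delta> $ j"]
    by (auto simp: inner_vec_def sum_negf)
  have "\<delta> = 0"
  proof (rule general_position_kernel[OF gp])
    show "c = transpose A *v v - g" by (simp add: g_def)
    show "(A *v \<delta>) $ k = 0" if "v $ k \<noteq> 0" for k
    proof -
      have "\<forall>k. v $ k * (A *v \<delta>) $ k = 0" using sums(1) vA by (simp add: sum_nonneg_eq_0_iff)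
      then show ?thesis using that by (metis mult_eq_0_iff)
    qed
    show "\<delta> $ j = 0" if "g $ j \<noteq> 0" for j
    proof -
      have "\<forall>j. g $ j * \<delta> $ j = 0" using sums(2) g\<delta> by (simp add: sum_nonneg_eq_0_iff)
      then show ?thesis using that by (metis mult_eq_0_iff)
    qed
  qed
  then show ?thesis using l(1) by (simp add: \<delta>_def)
qed

theorem general_position_optimum_rigid:
  fixes A :: "real ^ 'j ^ 'k"
  assumes T: "0 < T" and gp: "general_position c (append_identity (transpose A))"
    and P: "mclp_dual_feasible T A \<gamma> c P" and Pcont: "continuous_on {0<..<T} P"
    and Ppl: "piecewise_linear_on 0 T P"
    and compl: "\<And>U. mclp_optimal T A \<beta> b \<gamma> c U \<Longrightarrow> complementary T A \<beta> b \<gamma> c U P"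
    and U: "mclp_optimal T A \<beta> b \<gamma> c U" and V: "mclp_optimal T A \<beta> b \<gamma> c V"
  shows "continuous_on {0<..<T} U" and "piecewise_linear_on 0 T U"
    and "\<forall>t\<in>{0<..<T}. U t - Lim (at_right 0) U = V t - Lim (at_right 0) V"
proof -
  obtain n \<tau> where \<tau>: "\<tau> 0 = 0" "\<tau> n = T" "\<And>i. i < n \<Longrightarrow> \<tau> i < \<tau> (Suc i)"
    and aff: "\<And>i. i < n \<Longrightarrow> \<exists>v w. \<forall>t\<in>{\<tau> i<..<\<tau> (Suc i)}. P (T - t) = w + t *\<^sub>R v"
    using piecewise_linear_on_reverse[OF Ppl] unfolding piecewise_linear_on_def by metis
  have b: "0 \<le> \<tau> i" "\<tau> i < \<tau> (Suc i)" "\<tau> (Suc i) \<le> T" if "i < n" for i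
    using breakpoints_mono[where \<tau> = \<tau> and n = n, OF \<tau>(3), of 0 i]
      breakpoints_mono[where \<tau> = \<tau> and n = n, OF \<tau>(3), of "Suc i" n] \<tau> that by auto
  have piece: "\<exists>v w. \<forall>t\<in>{\<tau> i<..<\<tau> (Suc i)}. P (T - t) = w - t *\<^sub>R v" if i: "i < n" for i
  proof -
    obtain v w where "\<forall>t\<in>{\<tau> i<..<\<tau> (Suc i)}. P (T - t) = w + t *\<^sub>R v" using aff[OF i] by blast
    then have "\<forall>t\<in>{\<tau> i<..<\<tau> (Suc i)}. P (T - t) = w - t *\<^sub>R (- v)" by simp
    then show ?thesis by blast
  qed
  have feas: "mclp_feasible T A \<beta> b U" "admissible T U" if "mclp_optimal T A \<beta> b \<gamma> c U" for U
    using that by (auto simp: mclp_optimal_def mclp_feasible_def)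
  have rate: "\<exists>u. \<forall>U. mclp_optimal T A \<beta> b \<gamma> c U \<longrightarrow>
      (\<forall>s\<in>{\<tau> i<..<\<tau> (Suc i)}. \<forall>t\<in>{\<tau> i<..<\<tau> (Suc i)}. U t - U s = (t - s) *\<^sub>R u)" if i: "i < n" for i
  proof -
    obtain v w where vw: "\<forall>t\<in>{\<tau> i<..<\<tau> (Suc i)}. P (T - t) = w - t *\<^sub>R v" using piece[OF i] by blast
    obtain u where "\<forall>U. admissible T U \<longrightarrow> complementary T A \<beta> b \<gamma> c U P \<longrightarrow>
      (\<forall>s\<in>{\<tau> i<..<\<tau> (Suc i)}. \<forall>t\<in>{\<tau> i<..<\<tau> (Suc i)}. U t - U s = (t - s) *\<^sub>R u)"
      using rigid_rate[OF gp P b[OF i], of w v \<beta> b] vw by blast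
    then show ?thesis using feas compl by blast
  qed
  have cont: "isCont U x" if U: "mclp_optimal T A \<beta> b \<gamma> c U" and x: "x \<in> {0<..<T}" for U x
  proof -
    obtain i where i: "i < n" "\<tau> i < x" "x \<le> \<tau> (Suc i)"
      using breakpoint_interval[of \<tau> x n] \<tau> x by auto
    obtain v w where vw: "\<forall>t\<in>{\<tau> i<..<\<tau> (Suc i)}. P (T - t) = w - t *\<^sub>R v" using piece[OF i(1)] by blast
    have "(U \<longlongrightarrow> U x) (at_left x)"
    proof (rule rigid_left_continuous[OF gp feas(1)[OF U] P compl[OF U] b(1)[OF i(1)] i(2)])
      show "\<forall>t\<in>{\<tau> i<..<x}. P (T - t) = w - t *\<^sub>R v" using vw i by auto
      show "isCont P (T - x)" using Pcont x by (auto simp: continuous_on_eq_continuous_at)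
      show "isCont (\<lambda>t. c \<bullet> U t) x"
        using mclp_optimal_rate_concave(1)[OF T U] x by (auto simp: continuous_on_eq_continuous_at)
    qed (use x in auto)
    then show ?thesis
      using admissible_right_tendsto[OF feas(2)[OF U], of x] x by (simp add: isCont_def filterlim_at_split)
  qed
  show "continuous_on {0<..<T} U"
    using cont[OF U] by (intro continuous_at_imp_continuous_on) auto
  show "piecewise_linear_on 0 T U"
    unfolding piecewise_linear_on_def
  proof (intro exI[of _ n] exI[of _ \<tau>] conjI allI impI \<tau>)
    fix i assume i: "i < n"
    obtain u where u: "\<forall>s\<in>{\<tau> i<..<\<tau> (Suc i)}. \<forall>t\<in>{\<tau> i<..<\<tau> (Suc i)}. U t - U s = (t - s) *\<^sub>R u"
      using rate[OF i] U by blast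
    obtain m where m: "\<tau> i < m" "m < \<tau> (Suc i)" using dense[OF b(2)[OF i]] by blast
    have "U t = (U m - m *\<^sub>R u) + t *\<^sub>R u" if "t \<in> {\<tau> i<..<\<tau> (Suc i)}" for t
    proof -
      have "U t - U m = (t - m) *\<^sub>R u" using u m that by auto
      then show ?thesis by (simp add: algebra_simps)
    qed
    then show "\<exists>v w. \<forall>t\<in>{\<tau> i<..<\<tau> (Suc i)}. U t = w + t *\<^sub>R v" by blast
  qed
  show "\<forall>t\<in>{0<..<T}. U t - Lim (at_right 0) U = V t - Lim (at_right 0) V"
  proof
    fix t assume t: "t \<in> {0<..<T}"
    \<comment> \<open>\<open>U(0+)\<close> is \<open>U 0\<close> by right-continuity, so the difference of two optima has to be compared with its value at \<open>0\<close>.\<close>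
    have lim: "Lim (at_right 0) W = W 0" if "mclp_optimal T A \<beta> b \<gamma> c W" for W
      using admissible_right_tendsto[OF feas(2)[OF that], of 0] T by (intro tendsto_Lim) auto
    have contW: "continuous_on {0..t} W" if W: "mclp_optimal T A \<beta> b \<gamma> c W" for W
      unfolding continuous_on_def
    proof
      fix x assume x: "x \<in> {0..t}"
      show "(W \<longlongrightarrow> W x) (at x within {0..t})"
      proof (cases "x = 0")
        case True
        then show ?thesis
          using admissible_right_tendsto[OF feas(2)[OF W], of 0] T t at_within_Icc_at_right[of 0 t] by auto
      next
        case False
        then show ?thesis
          using cont[OF W, of x] x t by (auto simp: isCont_def intro: tendsto_within_subset)
      qed
    qed
    have "U t - V t = U 0 - V 0"
    proof (rule has_derivative_zero_unique_strong_interval[where k = "\<tau> ` {..n}" and a = 0 and b = t])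
      show "continuous_on {0..t} (\<lambda>x. U x - V x)" by (intro continuous_on_diff contW U V)
      show "((\<lambda>x. U x - V x) has_derivative (\<lambda>h. 0)) (at x within {0..t})" if x: "x \<in> {0..t} - \<tau> ` {..n}" for x
      proof -
        have "x \<noteq> 0" using x \<tau>(1) by (metis DiffD2 atMost_iff image_eqI zero_le)
        then obtain i where i: "i < n" "\<tau> i < x" "x \<le> \<tau> (Suc i)"
          using breakpoint_interval[of \<tau> x n] \<tau> x t by auto
        then have "x < \<tau> (Suc i)" using x by (auto simp: order.strict_iff_order)
        with i have xi: "x \<in> {\<tau> i<..<\<tau> (Suc i)}" by simp
        obtain u where u: "\<And>W s t. mclp_optimal T A \<beta> b \<gamma> c W \<Longrightarrow> s \<in> {\<tau> i<..<\<tau> (Suc i)} \<Longrightarrow>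
            t \<in> {\<tau> i<..<\<tau> (Suc i)} \<Longrightarrow> W t - W s = (t - s) *\<^sub>R u"
          using rate[OF i(1)] by blast
        have "U x - V x = U y - V y" if "y \<in> {\<tau> i<..<\<tau> (Suc i)}" for y
        proof -
          have "U x - U y = V x - V y" using u[OF U that xi] u[OF V that xi] by simp
          then show ?thesis by (simp add: algebra_simps)
        qed
        then have "((\<lambda>x. U x - V x) has_derivative (\<lambda>h. 0)) (at x)"
          by (intro has_derivative_transform_within_open[OF has_derivative_const _ xi]) auto
        then show ?thesis by (rule has_derivative_at_withinI)
      qed
    qed (use t in auto)
    then show "U t - Lim (at_right 0) U = V t - Lim (at_right 0) V"
      unfolding lim[OF U] lim[OF V] by (simp add: algebra_simps)
  qed
qed

section \<open>The structure theorem\<close>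

theorem theorem5p5:
  fixes T :: real
    and A :: "real ^ 'j ^ 'k"
    and \<beta> b :: "real ^ 'k"
    and \<gamma> c :: "real ^ 'j"
    and U\<^sub>O :: "real \<Rightarrow> real ^ 'j"
    and P\<^sub>O :: "real \<Rightarrow> real ^ 'k"
  assumes "T > 0"
    and "mclp_optimal T A \<beta> b \<gamma> c U\<^sub>O"
    and "mclp_dual_optimal T A \<beta> b \<gamma> c P\<^sub>O"
    and "mclp_value T \<gamma> c U\<^sub>O = mclp_dual_value T \<beta> b P\<^sub>O"
  shows "piecewise_linear_on 0 T (\<lambda>t. c \<bullet> U\<^sub>O t) \<and>
    (\<exists>U. mclp_optimal T A \<beta> b \<gamma> c U \<and>
      continuous_on {0<..<T} U \<and> piecewise_linear_on 0 T U) \<and>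
    (general_position c (append_identity (transpose A)) \<longrightarrow>
      (\<forall>U. mclp_optimal T A \<beta> b \<gamma> c U \<longrightarrow>
        continuous_on {0<..<T} U \<and> piecewise_linear_on 0 T U) \<and>
      (\<forall>U V. mclp_optimal T A \<beta> b \<gamma> c U \<longrightarrow> mclp_optimal T A \<beta> b \<gamma> c V \<longrightarrow>
        (\<forall>t\<in>{0<..<T}. U t - Lim (at_right 0) U = V t - Lim (at_right 0) V)))"
proof -
  note T = assms(1) and U\<^sub>O = assms(2) and P\<^sub>O = assms(3) and gap = assms(4)
  have compl: "complementary T A \<beta> b \<gamma> c U P"
    if "mclp_optimal T A \<beta> b \<gamma> c U" "mclp_dual_optimal T A \<beta> b \<gamma> c P" for U P
  proof (rule complementary_slackness[OF T])
    have "mclp_value T \<gamma> c U = mclp_value T \<gamma> c U\<^sub>O"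
      using that(1) U\<^sub>O by (auto simp: mclp_optimal_def intro: antisym)
    moreover have "mclp_dual_value T \<beta> b P = mclp_dual_value T \<beta> b P\<^sub>O"
      using that(2) P\<^sub>O by (auto simp: mclp_dual_optimal_def intro: antisym)
    ultimately show "mclp_value T \<gamma> c U = mclp_dual_value T \<beta> b P" using gap by simp
  qed (use that in \<open>auto simp: mclp_optimal_def mclp_dual_optimal_def\<close>)
  have aU: "admissible T U\<^sub>O" and aP: "admissible T P\<^sub>O"
    using U\<^sub>O P\<^sub>O by (auto simp: mclp_optimal_def mclp_feasible_def mclp_dual_optimal_def mclp_dual_feasible_def)
  have 1: "piecewise_linear_on 0 T (\<lambda>t. c \<bullet> U\<^sub>O t)"
    by (rule mclp_optimal_rate_piecewise_linear[OF T U\<^sub>O aP compl[OF U\<^sub>O P\<^sub>O]])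
  have 2: "\<exists>U. mclp_optimal T A \<beta> b \<gamma> c U \<and> continuous_on {0<..<T} U \<and> piecewise_linear_on 0 T U"
    by (rule mclp_piecewise_linear_optimum[OF T U\<^sub>O 1])
  \<comment> \<open>Parts (i) and (ii), applied to the dual problem, yield the piecewise linear \<open>P\<close> that (iii) needs.\<close>
  have P\<^sub>O': "mclp_optimal T (- transpose A) (- \<gamma>) (- c) (- \<beta>) (- b) P\<^sub>O"
    using P\<^sub>O by (simp add: mclp_dual_optimal_iff)
  have "piecewise_linear_on 0 T (\<lambda>t. (- b) \<bullet> P\<^sub>O t)"
    by (rule mclp_optimal_rate_piecewise_linear[OF T P\<^sub>O' aU complementary_dual[OF compl[OF U\<^sub>O P\<^sub>O]]])
  from mclp_piecewise_linear_optimum[OF T P\<^sub>O' this]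
  obtain P where P: "mclp_dual_optimal T A \<beta> b \<gamma> c P" "continuous_on {0<..<T} P" "piecewise_linear_on 0 T P"
    by (auto simp: mclp_dual_optimal_iff)
  have fP: "mclp_dual_feasible T A \<gamma> c P" using P(1) by (simp add: mclp_dual_optimal_def)
  show ?thesis
    using 1 2 general_position_optimum_rigid[OF T _ fP P(2,3) compl[OF _ P(1)]] by blast
qed

end
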